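(* Let $\mathfrak{H}$ be an infinite-dimensional separable complex Hilbert space. Let $\mathfrak{H}_{+}$ be a Hilbert space which is a dense linear subset of $\mathfrak{H}$, with $\|f\|_{\mathfrak{H}}\le C_{0}\|f\|_{\mathfrak{H}_{+}}$ for all $f\in\mathfrak{H}_{+}$ (some $C_{0}>0$), and with compact embedding $\mathfrak{H}_{+}\hookrightarrow\mathfrak{H}$. Let $\mathfrak{M}$ be a linear manifold dense in $\mathfrak{H}_{+}$ and let $L$ be a linear operator in $\mathfrak{H}$ defined on $\mathfrak{M}$ such that, for some constants $C_{1},C_{2}>0$, $$|(Lf,g)_{\mathfrak{H}}|\le C_{1}\|f\|_{\mathfrak{H}_{+}}\|g\|_{\mathfrak{H}_{+}},\qquad \mathrm{Re}(Lf,f)_{\mathfrak{H}}\ge C_{2}\|f\|_{\mathfrak{H}_{+}}^{2},\qquad f,g\in\mathfrak{M}.$$ Let $W$ be the m-sectorial operator determined by the restriction of $L$ to $\mathfrak{M}$ (its Friedrichs extension), let $R_{W}=W^{-1}$, and let $\mathfrak{Re}W$ be its real component. Assume that $$\|\mathfrak{Im}W/\mathfrak{Re}W\|_{2}<1$$ (this quantity is defined in the context). Then $$s_{n}(R_{W})\asymp\lambda_{n}^{-1}(\mathfrak{Re}W),$$ that is, there exist constants $c,C>0$ independent of $n$ such that $c\,\lambda_{n}^{-1}(\mathfrak{Re}W)\le s_{n}(R_{W})\le C\,\lambda_{n}^{-1}(\mathfrak{Re}W)$ for all $n\in\mathbb{N}$.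
   Context: The form $t[f,g]=(Lf,g)_{\mathfrak{H}}$, $f,g\in\mathfrak{M}$, is densely defined and sectorial; its closure $\tilde t$ is a closed sectorial form with domain $\mathfrak{H}_{+}$, and $W$ is the m-sectorial operator associated with $\tilde t$ by Kato's first representation theorem (the Friedrichs extension). Under the hypotheses $W$ is invertible with compact inverse $R_{W}=W^{-1}$. $H=\mathfrak{Re}W$ denotes the real part of $W$, i.e. the selfadjoint strictly positive operator associated with the closed symmetric form $\mathfrak{h}=(\tilde t+\tilde t^{\ast})/2$, where $\tilde t^{\ast}[u,v]=\overline{\tilde t[v,u]}$. It has compact inverse; $\lambda_{n}(\mathfrak{Re}W)$, $n\in\mathbb{N}$, are its eigenvalues $\lambda_{n}$ in nondecreasing order counted with multiplicity, and $\{e_{n}\}_{1}^{\infty}$ is a corresponding orthonormal basis of eigenvectors. By Kato's representation theorem there is a bounded selfadjoint operator $G$ on $\mathfrak{H}$ with $W=H^{1/2}(I+iG)H^{1/2}$ and $W^{\ast}=H^{1/2}(I-iG)H^{1/2}$, and one sets $\mathfrak{Im}W=H^{1/2}GH^{1/2}$. Let $b_{nk}=(Ge_{k},e_{n})_{\mathfrak{H}}$ be the matrix coefficients of $G$. The notation $\|\mathfrak{Im}W/\mathfrak{Re}W\|_{2}$ means the absolute (Hilbert–Schmidt) norm $$\|\mathfrak{Im}W/\mathfrak{Re}W\|_{2}:=\|H^{1/2}GH^{-1/2}\|_{2}:=\Big(\sum_{n,k=1}^{\infty}|b_{nk}|^{2}\lambda_{n}/\lambda_{k}\Big)^{1/2}.$$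 For a compact operator $A$, $s_{n}(A)$ denotes its singular numbers, i.e. the eigenvalues of $(A^{\ast}A)^{1/2}$ in nonincreasing order counted with multiplicity. *)

theory Defs
  imports "HOL-Analysis.Analysis"
begin

section \<open>Complex Hilbert spaces\<close>

text \<open>The norm and the topology are those of the underlying real inner product space; the complex
  inner product \<^term>\<open>cinner\<close> is linear in its first argument.\<close>

class complex_inner = real_inner +
  fixes scaleC :: "complex \<Rightarrow> 'a \<Rightarrow> 'a" (infixr "*\<^sub>C" 75)
    and cinner :: "'a \<Rightarrow> 'a \<Rightarrow> complex"
  assumes scaleC_add_right: "c *\<^sub>C (x + y) = c *\<^sub>C x + c *\<^sub>C y"
    and scaleC_add_left: "(c + d) *\<^sub>C x = c *\<^sub>C x + d *\<^sub>C x"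
    and scaleC_scaleC: "c *\<^sub>C d *\<^sub>C x = (c * d) *\<^sub>C x"
    and scaleR_scaleC: "scaleR r x = of_real r *\<^sub>C x"
    and cinner_commute: "cinner x y = cnj (cinner y x)"
    and cinner_add_left: "cinner (x + y) z = cinner x z + cinner y z"
    and cinner_scaleC_left: "cinner (c *\<^sub>C x) y = c * cinner x y"
    and inner_eq_Re_cinner: "inner x y = Re (cinner x y)"

class chilbert_space = complex_inner + complete_space

lemma scaleC_one: "1 *\<^sub>C x = (x :: 'a :: complex_inner)"
  using scaleR_scaleC[of 1 x] by simp

global_interpretation complex_vector:
  vector_space "scaleC :: complex \<Rightarrow> 'a \<Rightarrow> 'a :: complex_inner"
  defines csubspace = complex_vector.subspace
    and cspan = complex_vector.span
    and cdim = complex_vector.dim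
  by unfold_locales
    (auto simp: scaleC_add_right scaleC_add_left scaleC_scaleC scaleC_one)

definition infinite_dimensional :: "'a :: complex_inner itself \<Rightarrow> bool" where
  "infinite_dimensional _ \<longleftrightarrow> \<not> (\<exists>B :: 'a set. finite B \<and> cspan B = UNIV)"

definition orthonormal_basis :: "(nat \<Rightarrow> 'a :: complex_inner) \<Rightarrow> bool" where
  "orthonormal_basis e \<longleftrightarrow>
     (\<forall>m n. cinner (e m) (e n) = (if m = n then 1 else 0)) \<and> closure (cspan (range e)) = UNIV"

text \<open>A linear subset carrying its own inner product, whose values off the subset are irrelevant.\<close>

definition ip_norm :: "('a \<Rightarrow> 'a \<Rightarrow> complex) \<Rightarrow> 'a \<Rightarrow> real" where
  "ip_norm ip x = sqrt (Re (ip x x))"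

definition hilbert_on :: "'a :: complex_inner set \<Rightarrow> ('a \<Rightarrow> 'a \<Rightarrow> complex) \<Rightarrow> bool" where
  "hilbert_on V ip \<longleftrightarrow>
     csubspace V \<and>
     (\<forall>x\<in>V. \<forall>y\<in>V. \<forall>z\<in>V. ip (x + y) z = ip x z + ip y z) \<and>
     (\<forall>c. \<forall>x\<in>V. \<forall>y\<in>V. ip (c *\<^sub>C x) y = c * ip x y) \<and>
     (\<forall>x\<in>V. \<forall>y\<in>V. ip x y = cnj (ip y x)) \<and>
     (\<forall>x\<in>V. x \<noteq> 0 \<longrightarrow> Re (ip x x) > 0) \<and>
     (\<forall>X. (\<forall>n. X n \<in> V) \<and>
          (\<forall>\<epsilon>>0. \<exists>N. \<forall>m\<ge>N. \<forall>n\<ge>N. ip_norm ip (X m - X n) < \<epsilon>) \<longrightarrow>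
          (\<exists>x\<in>V. (\<lambda>n. ip_norm ip (X n - x)) \<longlonglongrightarrow> 0))"

section \<open>Unbounded operators, represented by their graphs\<close>

text \<open>The product \<open>B A\<close> (first \<open>A\<close>, then \<open>B\<close>) is the relational composition \<open>A O B\<close>, and the inverse
  is the converse relation.\<close>

type_synonym 'a operator = "('a \<times> 'a) set"

definition op_graph :: "('a \<Rightarrow> 'a) \<Rightarrow> 'a operator" where
  "op_graph f = range (\<lambda>x. (x, f x))"

definition adjoint_op :: "'a :: complex_inner operator \<Rightarrow> 'a operator" where
  "adjoint_op T = {(v, w). \<forall>(x, y)\<in>T. cinner y v = cinner x w}"

definition selfadjoint_op :: "'a :: complex_inner operator \<Rightarrow> bool" where
  "selfadjoint_op T \<longleftrightarrow> closure (Domain T) = UNIV \<and> adjoint_op T = T"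

definition nonneg_op :: "'a :: complex_inner operator \<Rightarrow> bool" where
  "nonneg_op T \<longleftrightarrow> (\<forall>(x, y)\<in>T. Re (cinner y x) \<ge> 0)"

definition sqrt_op :: "'a :: complex_inner operator \<Rightarrow> 'a operator" where
  "sqrt_op T = (THE S. selfadjoint_op S \<and> nonneg_op S \<and> S O S = T)"

definition modulus_op :: "'a :: complex_inner operator \<Rightarrow> 'a operator" where
  "modulus_op A = sqrt_op (A O adjoint_op A)"

definition eigenspace :: "'a :: complex_inner operator \<Rightarrow> complex \<Rightarrow> 'a set" where
  "eigenspace T \<mu> = {x. (x, \<mu> *\<^sub>C x) \<in> T}"

text \<open>Sequences are indexed from 0, so \<open>l 0\<close> is the first eigenvalue. The multiplicity of an eigenvalue
  is the dimension of its eigenspace; a real number that is not an eigenvalue has the eigenspace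
  \<open>{0}\<close> and is therefore not attained by the sequence. (\<^term>\<open>cdim\<close> is 0 on infinite-dimensional spaces; the operators
  meant here are those with compact inverse, whose eigenspaces are finite-dimensional.)\<close>

definition eigenvalues_nondecreasing :: "'a :: complex_inner operator \<Rightarrow> (nat \<Rightarrow> real) \<Rightarrow> bool" where
  "eigenvalues_nondecreasing T l \<longleftrightarrow>
     incseq l \<and>
     (\<forall>\<mu>. finite {n. l n = \<mu>} \<and> card {n. l n = \<mu>} = cdim (eigenspace T (of_real \<mu>)))"

text \<open>Singular numbers of a compact operator on an infinite-dimensional space. Only positive
  eigenvalues of the modulus are counted with multiplicity: for an operator of finite rank the
  sequence ends in zeros, and for infinite rank the kernel contributes no term.\<close>

definition singular_number :: "'a :: complex_inner operator \<Rightarrow> nat \<Rightarrow> real" where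
  "singular_number A = (THE s.
     decseq s \<and> (\<forall>n. s n \<ge> 0) \<and>
     (\<forall>\<mu>>0. finite {n. s n = \<mu>} \<and>
            card {n. s n = \<mu>} = cdim (eigenspace (modulus_op A) (of_real \<mu>))))"

section \<open>Sesquilinear forms\<close>

text \<open>A form is given by its domain \<open>D\<close> and a function \<open>t\<close>, linear in the first argument, whose values
  off \<open>D\<close> are irrelevant. The closure is Kato's, via \<open>t\<close>-convergent sequences.\<close>

definition form_converges ::
    "'a set \<Rightarrow> ('a \<Rightarrow> 'a \<Rightarrow> complex) \<Rightarrow> (nat \<Rightarrow> 'a :: complex_inner) \<Rightarrow> 'a \<Rightarrow> bool" where
  "form_converges D t X u \<longleftrightarrow>
     (\<forall>n. X n \<in> D) \<and> X \<longlonglongrightarrow> u \<and>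
     (\<forall>\<epsilon>>0. \<exists>N. \<forall>m\<ge>N. \<forall>n\<ge>N. cmod (t (X m - X n) (X m - X n)) < \<epsilon>)"

definition form_closure_domain ::
    "'a set \<Rightarrow> ('a \<Rightarrow> 'a \<Rightarrow> complex) \<Rightarrow> 'a :: complex_inner set" where
  "form_closure_domain D t = {u. \<exists>X. form_converges D t X u}"

definition form_closure ::
    "'a set \<Rightarrow> ('a \<Rightarrow> 'a \<Rightarrow> complex) \<Rightarrow> 'a :: complex_inner \<Rightarrow> 'a \<Rightarrow> complex" where
  "form_closure D t u v = (THE z. \<forall>X Y.
     form_converges D t X u \<and> form_converges D t Y v \<longrightarrow> (\<lambda>n. t (X n) (Y n)) \<longlonglongrightarrow> z)"

definition real_part_form :: "('a \<Rightarrow> 'a \<Rightarrow> complex) \<Rightarrow> 'a \<Rightarrow> 'a \<Rightarrow> complex" where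
  "real_part_form t u v = (t u v + cnj (t v u)) / 2"

text \<open>The operator associated with a closed sectorial form by Kato's first representation theorem.\<close>

definition form_operator ::
    "'a set \<Rightarrow> ('a \<Rightarrow> 'a \<Rightarrow> complex) \<Rightarrow> 'a :: complex_inner operator" where
  "form_operator D t = {(u, w). u \<in> D \<and> (\<forall>v\<in>D. t u v = cinner w v)}"

section \<open>The Friedrichs extension and its real part\<close>

definition friedrichs :: "'a set \<Rightarrow> ('a \<Rightarrow> 'a) \<Rightarrow> 'a :: complex_inner operator" where
  "friedrichs M L = (let t = (\<lambda>f g. cinner (L f) g) in
     form_operator (form_closure_domain M t) (form_closure M t))"

definition friedrichs_Re :: "'a set \<Rightarrow> ('a \<Rightarrow> 'a) \<Rightarrow> 'a :: complex_inner operator" where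
  "friedrichs_Re M L = (let t = (\<lambda>f g. cinner (L f) g) in
     form_operator (form_closure_domain M t) (real_part_form (form_closure M t)))"

text \<open>\<open>G\<close> is the bounded selfadjoint operator with \<open>W = H\<^bsup>1/2\<^esup> (I + iG) H\<^bsup>1/2\<^esup>\<close> and
  \<open>W\<^sup>* = H\<^bsup>1/2\<^esup> (I - iG) H\<^bsup>1/2\<^esup>\<close>; then \<open>Im W = H\<^bsup>1/2\<^esup> G H\<^bsup>1/2\<^esup>\<close>.\<close>

definition kato_factor ::
    "'a operator \<Rightarrow> 'a operator \<Rightarrow> ('a :: complex_inner \<Rightarrow> 'a) \<Rightarrow> bool" where
  "kato_factor W H G \<longleftrightarrow>
     bounded_linear G \<and> (\<forall>c x. G (c *\<^sub>C x) = c *\<^sub>C G x) \<and>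
     (\<forall>x y. cinner (G x) y = cinner x (G y)) \<and>
     W = sqrt_op H O op_graph (\<lambda>x. x + \<i> *\<^sub>C G x) O sqrt_op H \<and>
     adjoint_op W = sqrt_op H O op_graph (\<lambda>x. x - \<i> *\<^sub>C G x) O sqrt_op H"

text \<open>The Hilbert-Schmidt norm of \<open>H\<^bsup>1/2\<^esup> G H\<^bsup>-1/2\<^esup>\<close> in terms of an orthonormal eigenbasis \<open>e\<close> of \<open>H\<close>
  with eigenvalues \<open>l\<close>; it is infinite if the double series diverges.\<close>

definition im_over_re_norm ::
    "('a :: complex_inner \<Rightarrow> 'a) \<Rightarrow> (nat \<Rightarrow> 'a) \<Rightarrow> (nat \<Rightarrow> real) \<Rightarrow> ereal" where
  "im_over_re_norm G e l =
     (let a = (\<lambda>(n, k). (cmod (cinner (G (e k)) (e n)))\<^sup>2 * l n / l k)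
      in if a summable_on UNIV then ereal (sqrt (infsum a UNIV)) else \<infinity>)"

end

theory Submission
  imports Defs
begin

text \<open>Put \<open>B = H\<^bsup>1/2\<^esup> G H\<^bsup>-1/2\<^esup>\<close>. The hypothesis says that the Hilbert-Schmidt norm \<open>\<beta>\<close> of \<open>B\<close> is less than 1, so
  \<open>I + iB\<close> is boundedly invertible. As \<open>(I + iG) H\<^bsup>-1/2\<^esup> = H\<^bsup>-1/2\<^esup> (I + iB)\<close>, the factorisation
  \<open>W = H\<^bsup>1/2\<^esup> (I + iG) H\<^bsup>1/2\<^esup>\<close> becomes \<open>W\<^bsup>-1\<^esup> = H\<^bsup>-1\<^esup> (I + iB)\<^bsup>-1\<^esup>\<close>, and a min-max argument compares the
  singular numbers of \<open>W\<^bsup>-1\<^esup>\<close> with those of \<open>H\<^bsup>-1\<^esup>\<close>, with constants \<open>1/(1 + \<beta>)\<close> and \<open>1/(1 - \<beta>)\<close>. The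
  adjoint of \<open>W\<^bsup>-1\<^esup>\<close> has the same form with \<open>-G\<close> in place of \<open>G\<close>, so no representation theorem
  for functionals is needed.\<close>

section \<open>Complex inner products\<close>

text \<open>\<open>form_closure\<close>, \<open>sqrt_op\<close> and \<open>singular_number\<close>
  are definite descriptions, so each value needs a uniqueness argument before it can be computed.
  Diagonal operators carry most of this: once an operator is known to be \<open>diag_op\<close> in
  an orthonormal basis, its square root is taken entrywise and its eigenspaces are spanned by basis
  vectors. The reduction is used twice: for \<open>H\<close> in the given basis \<open>e\<close>,
  where closedness of the form makes \<open>H\<close> the maximal diagonal operator, and for A'A
  with A = W^-1 and A' its adjoint, where the basis is constructed from compactness. The obstacle is
  that H^(1/2) G H^(-1/2) is only formal: \<open>G\<close> need not map the domain of H^(1/2) into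
  itself. The Hilbert-Schmidt bound repairs this, since the formal coefficients turn out square
  summable for every vector and so define a bounded operator on the whole space. That its bound is
  below 1, not merely finite, makes the fixed point equation behind the inverse of I + iB a
  contraction. H^(-1) is compact because \<open>H\<close> controls the norm of \<open>Hp\<close>,
  whose unit ball is precompact in the ambient space.\<close>

lemma cinner_scaleC_right: "cinner x (c *\<^sub>C y) = cnj c * cinner x y"
  by (metis cinner_commute cinner_scaleC_left complex_cnj_mult)

lemma cinner_add_right: "cinner x (y + z) = cinner x y + cinner x z"
  by (metis cinner_add_left cinner_commute complex_cnj_add)

lemma cinner_self: "cinner x x = of_real ((norm x)\<^sup>2)"
proof -
  have "Im (cinner x x) = 0"
    using arg_cong[OF cinner_commute[of x x], of Im] by simp
  then show ?thesis
    by (simp add: complex_eq_iff power2_norm_eq_inner inner_eq_Re_cinner)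
qed

lemma norm_scaleC: "norm (c *\<^sub>C x) = cmod c * norm x"
proof -
  have "complex_of_real ((norm (c *\<^sub>C x))\<^sup>2) = (c * cnj c) * cinner x x"
    unfolding cinner_self[symmetric] cinner_scaleC_left cinner_scaleC_right by simp
  also have "\<dots> = of_real ((cmod c)\<^sup>2 * (norm x)\<^sup>2)"
    unfolding complex_norm_square[symmetric] cinner_self by simp
  finally have "(norm (c *\<^sub>C x))\<^sup>2 = (cmod c)\<^sup>2 * (norm x)\<^sup>2"
    using of_real_eq_iff by blast
  then show ?thesis
    by (metis norm_ge_zero power2_eq_imp_eq power_mult_distrib zero_le_mult_iff)
qed

lemma cmod_cinner_le: "cmod (cinner x y) \<le> norm x * norm y"
proof (cases "cinner x y = 0")
  case False
  \<comment> \<open>A unimodular factor rotates \<open>cinner x y\<close> onto its modulus, so that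
    the real Cauchy-Schwarz inequality applies.\<close>
  define a where "a = cnj (cinner x y) / of_real (cmod (cinner x y))"
  have "cmod a = 1"
    using False by (simp add: a_def norm_divide)
  have "a * cinner x y = of_real (cmod (cinner x y))"
    using False by (simp add: a_def complex_norm_square[symmetric] power2_eq_square mult.commute)
  then have "cmod (cinner x y) = Re (cinner (a *\<^sub>C x) y)"
    by (simp add: cinner_scaleC_left)
  also have "\<dots> \<le> norm (a *\<^sub>C x) * norm y"
    by (metis inner_eq_Re_cinner norm_cauchy_schwarz)
  finally show ?thesis
    by (simp add: norm_scaleC \<open>cmod a = 1\<close>)
qed simp

lemma scaleC_of_real: "of_real r *\<^sub>C x = r *\<^sub>R x"
  by (simp add: scaleR_scaleC)

text \<open>Conjugate-linear maps are real-linear, so the library's limit, sum and difference rules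
  for bounded bilinear maps become available.\<close>

interpretation cinner: bounded_bilinear "cinner :: 'a :: complex_inner \<Rightarrow> 'a \<Rightarrow> complex"
proof
  show "\<exists>K. \<forall>a b :: 'a. cmod (cinner a b) \<le> norm a * norm b * K"
    by (rule exI[of _ 1]) (simp add: cmod_cinner_le)
qed (simp_all add: cinner_add_left cinner_add_right scaleR_scaleC cinner_scaleC_left
    cinner_scaleC_right scaleR_conv_of_real)

interpretation scaleC: bounded_bilinear "scaleC :: complex \<Rightarrow> 'a :: complex_inner \<Rightarrow> 'a"
proof
  show "\<exists>K. \<forall>(c :: complex) (x :: 'a). norm (c *\<^sub>C x) \<le> norm c * norm x * K"
    by (rule exI[of _ 1]) (simp add: norm_scaleC)
qed (simp_all add: scaleC_add_right scaleC_add_left scaleR_scaleC scaleC_scaleC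
    scaleR_conv_of_real mult.commute)

lemma norm_add_sq:
  "(norm (x + y))\<^sup>2 = (norm x)\<^sup>2 + (norm y)\<^sup>2 + 2 * Re (cinner x y)" for x y :: "'a :: complex_inner"
  by (simp add: power2_norm_eq_inner inner_add_left inner_add_right inner_commute[of y x]
      inner_eq_Re_cinner[of x y])

lemma cinner_eq_0_iff_commute: "cinner x y = 0 \<longleftrightarrow> cinner y x = 0"
  by (metis cinner_commute complex_cnj_zero_iff)

section \<open>Underdetermined homogeneous systems\<close>

text \<open>Gaussian elimination of the last unknown: if its column vanishes, a unit vector is a
  solution; otherwise a pivot row \<open>p\<close> removes it from the other \<open>n\<close> rows.
  This is the dimension count behind the min-max argument.\<close>

lemma underdetermined_system:
  fixes a :: "nat \<Rightarrow> nat \<Rightarrow> complex"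
  shows "\<exists>c. (\<exists>j\<le>n. c j \<noteq> 0) \<and> (\<forall>i<n. (\<Sum>j\<le>n. c j * a i j) = 0)"
proof (induction n arbitrary: a)
  case 0
  show ?case by (rule exI[of _ "\<lambda>_. 1"]) simp
next
  case (Suc n)
  show ?case
  proof (cases "\<exists>i<Suc n. a i (Suc n) \<noteq> 0")
    case False
    then show ?thesis
      by (intro exI[of _ "\<lambda>j. if j = Suc n then 1 else 0"]) (auto intro!: sum.neutral)
  next
    case True
    then obtain p where p: "p < Suc n" "a p (Suc n) \<noteq> 0"
      by blast
    \<comment> \<open>Enumerates the rows other than the pivot row \<open>p\<close>.\<close>
    define skip where "skip i = (if i < p then i else Suc i)" for i
    define q where "q i = a i (Suc n) / a p (Suc n)" for i
    obtain c where c: "\<exists>j\<le>n. c j \<noteq> 0"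
      and ci: "\<And>i. i < n \<Longrightarrow> (\<Sum>j\<le>n. c j * (a (skip i) j - q (skip i) * a p j)) = 0"
      using Suc.IH[of "\<lambda>i j. a (skip i) j - q (skip i) * a p j"] by blast
    \<comment> \<open>The last unknown is solved from row \<open>p\<close>. The remaining rows then
      reduce to the system already solved by \<open>c\<close>, and row \<open>p\<close> itself
      cancels because \<open>q p = 1\<close>.\<close>
    define d where "d j = (if j = Suc n then - (\<Sum>j\<le>n. c j * a p j) / a p (Suc n) else c j)" for j
    have ds: "(\<Sum>j\<le>Suc n. d j * a i j) = (\<Sum>j\<le>n. c j * (a i j - q i * a p j))" for i
    proof -
      have "(\<Sum>j\<le>Suc n. d j * a i j) = (\<Sum>j\<le>n. c j * a i j) + d (Suc n) * a i (Suc n)"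
        by (simp add: d_def)
      also have "d (Suc n) * a i (Suc n) = - (\<Sum>j\<le>n. c j * (q i * a p j))"
        by (simp add: d_def q_def sum_distrib_left sum_divide_distrib sum_negf[symmetric] mult_ac)
      finally show ?thesis
        by (simp add: right_diff_distrib sum_subtractf)
    qed
    have "(\<Sum>j\<le>Suc n. d j * a i j) = 0" if "i < Suc n" for i
    proof (cases "i = p")
      case True
      then show ?thesis
        using p by (simp only: ds) (simp add: q_def)
    next
      case False
      then have "i = skip (if i < p then i else i - 1)" "(if i < p then i else i - 1) < n"
        using that p by (auto simp: skip_def)
      then show ?thesis
        using ci[of "if i < p then i else i - 1"] by (simp only: ds)
    qed
    moreover have "\<exists>j\<le>Suc n. d j \<noteq> 0"
      using c by (metis d_def le_SucI not_less_eq_eq order_refl)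
    ultimately show ?thesis
      by blast
  qed
qed

section \<open>Orthonormal sequences\<close>

locale orthonormal =
  fixes e :: "nat \<Rightarrow> 'a :: chilbert_space"
  assumes orthonormal: "cinner (e m) (e n) = (if m = n then 1 else 0)"
begin

lemma norm_e [simp]: "norm (e n) = 1"
proof -
  have "complex_of_real ((norm (e n))\<^sup>2) = 1"
    using cinner_self[of "e n"] orthonormal[of n n] by simp
  then have "(norm (e n))\<^sup>2 = 1"
    using of_real_eq_1_iff by blast
  then show ?thesis
    by (simp add: power2_eq_1_iff) (smt (verit) norm_ge_zero)
qed

lemma cinner_sum_e:
  "finite A \<Longrightarrow> cinner (\<Sum>n\<in>A. c n *\<^sub>C e n) (e m) = (if m \<in> A then c m else 0)"
  by (simp add: cinner.sum_left cinner_scaleC_left orthonormal if_distrib[of "(*) _"] sum.delta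
      cong: if_cong)

lemma norm_sum_e:
  assumes "finite A"
  shows "(norm (\<Sum>n\<in>A. c n *\<^sub>C e n))\<^sup>2 = (\<Sum>n\<in>A. (cmod (c n))\<^sup>2)"
proof -
  let ?S = "\<Sum>n\<in>A. c n *\<^sub>C e n"
  have "complex_of_real ((norm ?S)\<^sup>2) = (\<Sum>n\<in>A. cnj (c n) * cinner ?S (e n))"
    unfolding cinner_self[symmetric] cinner.sum_right[of ?S] cinner_scaleC_right ..
  also have "\<dots> = (\<Sum>n\<in>A. cnj (c n) * c n)"
    using assms by (intro sum.cong) (auto simp: cinner_sum_e)
  also have "\<dots> = of_real (\<Sum>n\<in>A. (cmod (c n))\<^sup>2)"
    unfolding of_real_sum complex_norm_square by (simp add: mult.commute)
  finally show ?thesis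
    using of_real_eq_iff by blast
qed

lemma bessel:
  assumes "finite A"
  shows "(\<Sum>n\<in>A. (cmod (cinner x (e n)))\<^sup>2) \<le> (norm x)\<^sup>2"
proof -
  let ?S = "\<Sum>n\<in>A. cinner x (e n) *\<^sub>C e n"
  have "cinner (x - ?S) (e n) = 0" if "n \<in> A" for n
    using that assms by (simp add: cinner.diff_left cinner_sum_e)
  then have "cinner (x - ?S) ?S = 0"
    using assms by (simp add: cinner.sum_right[of "x - ?S"] cinner_scaleC_right)
  then have "(norm x)\<^sup>2 = (norm (x - ?S))\<^sup>2 + (norm ?S)\<^sup>2"
    using norm_add_sq[of "x - ?S" ?S] by simp
  then show ?thesis
    by (simp add: norm_sum_e[OF assms])
qed

text \<open>The source of almost every vector constructed below, and the place where completeness of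
  the space enters.\<close>

lemma riesz_fischer:
  assumes "\<And>N. (\<Sum>n<N. (cmod (c n))\<^sup>2) \<le> C"
  obtains x where "(\<lambda>N. \<Sum>n<N. c n *\<^sub>C e n) \<longlonglongrightarrow> x" "\<And>n. cinner x (e n) = c n"
    "(norm x)\<^sup>2 \<le> C"
proof -
  let ?S = "\<lambda>N. \<Sum>n<N. c n *\<^sub>C e n"
  let ?s = "\<lambda>N. \<Sum>n<N. (cmod (c n))\<^sup>2"
  have "summable (\<lambda>n. (cmod (c n))\<^sup>2)"
    using assms by (intro bounded_imp_summable[of _ C])
      (auto simp only: lessThan_Suc_atMost[symmetric] zero_le_power2)
  then have "Cauchy ?s"
    by (simp add: summable_iff_convergent convergent_Cauchy)
  \<comment> \<open>Orthonormality turns gaps between the vector partial sums into gaps between the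
    numerical ones, which transfers the Cauchy property.\<close>
  have eq: "(norm (?S n - ?S m))\<^sup>2 = ?s n - ?s m" if "m \<le> n" for m n
  proof -
    have "{..<n} = {..<m} \<union> {m..<n}"
      using that by auto
    then have "?S n - ?S m = (\<Sum>k\<in>{m..<n}. c k *\<^sub>C e k)" "?s n - ?s m = (\<Sum>k\<in>{m..<n}. (cmod (c k))\<^sup>2)"
      by (auto simp: sum.union_disjoint ivl_disj_int)
    then show ?thesis
      by (simp add: norm_sum_e)
  qed
  have eq': "(norm (?S n - ?S m))\<^sup>2 = \<bar>?s n - ?s m\<bar>" for m n
  proof (cases "m \<le> n")
    case True
    then show ?thesis
      using eq[OF True] zero_le_power2[of "norm (?S n - ?S m)"] by linarith
  next
    case False
    then show ?thesis
      using eq[of n m] zero_le_power2[of "norm (?S m - ?S n)"] by (simp add: norm_minus_commute)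
  qed
  have "Cauchy ?S"
  proof (rule CauchyI)
    fix \<epsilon> :: real assume "\<epsilon> > 0"
    then obtain N where N: "\<forall>m\<ge>N. \<forall>n\<ge>N. norm (?s m - ?s n) < \<epsilon>\<^sup>2"
      using CauchyD[OF \<open>Cauchy ?s\<close>, of "\<epsilon>\<^sup>2"] by auto
    have "norm (?S m - ?S n) < \<epsilon>" if "m \<ge> N" "n \<ge> N" for m n
    proof (rule power2_less_imp_less)
      show "(norm (?S m - ?S n))\<^sup>2 < \<epsilon>\<^sup>2"
        using N that by (simp add: eq')
    qed (use \<open>\<epsilon> > 0\<close> in simp)
    then show "\<exists>N. \<forall>m\<ge>N. \<forall>n\<ge>N. norm (?S m - ?S n) < \<epsilon>"
      by blast
  qed
  then obtain x where x: "?S \<longlonglongrightarrow> x"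
    using Cauchy_convergent_iff convergent_def by blast
  have "cinner x (e n) = c n" for n
  proof (rule LIMSEQ_unique)
    show "(\<lambda>N. cinner (?S N) (e n)) \<longlonglongrightarrow> cinner x (e n)"
      by (intro cinner.tendsto x tendsto_const)
    show "(\<lambda>N. cinner (?S N) (e n)) \<longlonglongrightarrow> c n"
      by (rule tendsto_eventually, rule eventually_sequentiallyI[of "Suc n"])
        (simp add: cinner_sum_e)
  qed
  moreover have "(norm x)\<^sup>2 \<le> C"
    by (rule LIMSEQ_le_const2[OF tendsto_power[OF tendsto_norm[OF x]]])
      (use assms in \<open>auto simp: norm_sum_e\<close>)
  ultimately show thesis
    using x by (intro that)
qed

text \<open>An (n+1)-dimensional span meets \<open>n\<close> linear conditions nontrivially. The
  conditions are written as sums because \<open>u\<close> is an arbitrary function here; it is later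
  the identity, \<open>P\<close> or \<open>Q\<close>.\<close>

lemma orthogonal_vector_in_span:
  obtains c x where "x = (\<Sum>j\<le>n. c j *\<^sub>C e j)" "x \<noteq> 0"
    "\<And>i. i < n \<Longrightarrow> (\<Sum>j\<le>n. c j * cinner (u (e j)) (g i)) = 0"
proof -
  obtain c where c: "\<exists>j\<le>n. c j \<noteq> 0" "\<forall>i<n. (\<Sum>j\<le>n. c j * cinner (u (e j)) (g i)) = 0"
    using underdetermined_system[of n "\<lambda>i j. cinner (u (e j)) (g i)"] by blast
  then obtain j where "j \<le> n" "c j \<noteq> 0"
    by blast
  then have "cinner (\<Sum>j\<le>n. c j *\<^sub>C e j) (e j) \<noteq> 0"
    by (simp add: cinner_sum_e)
  then have "(\<Sum>j\<le>n. c j *\<^sub>C e j) \<noteq> 0"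
    using cinner.zero_left by metis
  then show thesis
    using c(2) by (intro that[OF refl]) auto
qed

end

text \<open>Totality is stated as a trivial orthogonal complement: this is what the spectral theorem
  delivers, and it lets vectors be identified by their coefficients.\<close>

locale onb = orthonormal +
  assumes total: "(\<And>n. cinner x (e n) = 0) \<Longrightarrow> x = 0"
begin

lemma eqI: "(\<And>n. cinner x (e n) = cinner y (e n)) \<Longrightarrow> x = y"
  using total[of "x - y"] by (simp add: cinner.diff_left)

lemma expansion: "(\<lambda>N. \<Sum>n<N. cinner x (e n) *\<^sub>C e n) \<longlonglongrightarrow> x"
proof -
  have "\<And>N. (\<Sum>n<N. (cmod (cinner x (e n)))\<^sup>2) \<le> (norm x)\<^sup>2"
    by (intro bessel) simp
  from riesz_fischer[OF this] obtain y
    where y: "(\<lambda>N. \<Sum>n<N. cinner x (e n) *\<^sub>C e n) \<longlonglongrightarrow> y" "\<And>n. cinner y (e n) = cinner x (e n)"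
    by metis
  have "y = x"
    by (rule eqI) (rule y(2))
  with y(1) show ?thesis
    by simp
qed

lemma parseval: "(\<lambda>n. cinner x (e n) * cnj (cinner y (e n))) sums cinner x y"
proof -
  have "(\<lambda>N. cinner (\<Sum>n<N. cinner x (e n) *\<^sub>C e n) y) \<longlonglongrightarrow> cinner x y"
    by (intro cinner.tendsto expansion tendsto_const)
  then show ?thesis
    unfolding sums_def cinner.sum_left cinner_scaleC_left cinner_commute[of y, symmetric]
      cinner_commute[of "e _" y] .
qed

lemma parseval_norm: "(\<lambda>n. (cmod (cinner x (e n)))\<^sup>2) sums (norm x)\<^sup>2"
  using sums_Re[OF parseval[of x x]]
  unfolding complex_norm_square[symmetric] cinner_self Re_complex_of_real .

lemma norm_le_by_coeffs:
  assumes "C \<ge> 0" "\<And>n. cmod (cinner x (e n)) \<le> C * cmod (cinner y (e n))"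
  shows "norm x \<le> C * norm y"
proof (rule power2_le_imp_le)
  have "(norm x)\<^sup>2 \<le> C\<^sup>2 * (norm y)\<^sup>2"
    by (rule sums_le[OF _ parseval_norm sums_mult[OF parseval_norm]])
      (metis assms(2) norm_ge_zero power_mono power_mult_distrib)
  then show "(norm x)\<^sup>2 \<le> (C * norm y)\<^sup>2"
    by (simp add: power_mult_distrib)
qed (use assms in simp)

lemma coefficients_dominated:
  assumes "C \<ge> 0" "\<And>n. cmod (c n) \<le> C * cmod (cinner y (e n))"
  obtains x where "\<And>n. cinner x (e n) = c n"
proof -
  have "(\<Sum>n<N. (cmod (c n))\<^sup>2) \<le> C\<^sup>2 * (norm y)\<^sup>2" for N
  proof -
    have "(\<Sum>n<N. (cmod (c n))\<^sup>2) \<le> (\<Sum>n<N. C\<^sup>2 * (cmod (cinner y (e n)))\<^sup>2)"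
      by (intro sum_mono) (metis assms(2) norm_ge_zero power_mono power_mult_distrib)
    also have "\<dots> \<le> C\<^sup>2 * (norm y)\<^sup>2"
      by (simp add: sum_distrib_left[symmetric] mult_left_mono bessel)
    finally show ?thesis .
  qed
  from riesz_fischer[OF this] obtain x where "\<And>n. cinner x (e n) = c n"
    by metis
  then show thesis
    by (rule that)
qed

end

text \<open>The vectors orthogonal to \<open>x\<close> form a closed subspace containing the basis,
  hence the whole space, and so \<open>x\<close> itself.\<close>

lemma onb_of_orthonormal_basis:
  assumes "orthonormal_basis (e :: nat \<Rightarrow> 'a :: chilbert_space)"
  shows "onb e"
proof
  show "cinner (e m) (e n) = (if m = n then 1 else 0)" for m n
    using assms by (simp add: orthonormal_basis_def)
  fix x assume x: "\<And>n. cinner x (e n) = 0"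
  have "cspan (range e) \<subseteq> {y. cinner x y = 0}"
    by (rule complex_vector.span_minimal)
      (auto simp: x complex_vector.subspace_def cinner_add_right cinner_scaleC_right
        cinner.zero_right)
  moreover have "closed {y. cinner x y = 0}"
    by (intro closed_Collect_eq linear_continuous_on cinner.bounded_linear_right continuous_on_const)
  ultimately have "closure (cspan (range e)) \<subseteq> {y. cinner x y = 0}"
    by (rule closure_minimal)
  then have "cinner x x = 0"
    using assms by (auto simp: orthonormal_basis_def)
  then show "x = 0"
    by (simp add: cinner_self)
qed

section \<open>Diagonal operators and their square roots\<close>

text \<open>The maximal diagonal operator, for possibly unbounded \<open>d\<close>: existence of
  \<open>y\<close> already encodes the square summability that defines the domain.\<close>

definition diag_op :: "(nat \<Rightarrow> 'a :: complex_inner) \<Rightarrow> (nat \<Rightarrow> real) \<Rightarrow> 'a operator" where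
  "diag_op e d = {(x, y). \<forall>n. cinner y (e n) = of_real (d n) * cinner x (e n)}"

lemma diag_opD: "(x, y) \<in> diag_op e d \<Longrightarrow> cinner y (e n) = of_real (d n) * cinner x (e n)"
  by (simp add: diag_op_def)

lemma adjoint_opD: "(v, w) \<in> adjoint_op T \<Longrightarrow> (x, y) \<in> T \<Longrightarrow> cinner y v = cinner x w"
  by (auto simp: adjoint_op_def)

lemma adjoint_op_diff:
  assumes "(v, w) \<in> adjoint_op T" "(v', w') \<in> adjoint_op T"
  shows "(v - v', w - w') \<in> adjoint_op T"
  using assms by (fastforce simp: adjoint_op_def cinner.diff_right)

lemma adjoint_op_scaleC:
  "(v, w) \<in> adjoint_op T \<Longrightarrow> (c *\<^sub>C v, c *\<^sub>C w) \<in> adjoint_op T"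
  by (auto simp: adjoint_op_def cinner_scaleC_right)

text \<open>The defining equation of the adjoint is symmetric under swapping the entries of both
  pairs. This carries the formula for the adjoint of \<open>W\<close> over to the inverse.\<close>

lemma adjoint_op_converse: "adjoint_op (T\<inverse>) = (adjoint_op T)\<inverse>"
proof -
  have "(v, w) \<in> adjoint_op (T\<inverse>) \<longleftrightarrow> (w, v) \<in> adjoint_op T" for v w
    unfolding adjoint_op_def by (auto intro: sym)
  then show ?thesis
    by auto
qed

context onb
begin

lemma diag_op_unique: "(x, y) \<in> diag_op e d \<Longrightarrow> (x, z) \<in> diag_op e d \<Longrightarrow> y = z"
  by (rule eqI) (simp add: diag_opD)

lemma diag_op_sum:
  "finite A \<Longrightarrow>
    (\<Sum>n\<in>A. c n *\<^sub>C e n, \<Sum>n\<in>A. (of_real (d n) * c n) *\<^sub>C e n) \<in> diag_op e d"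
  by (simp add: diag_op_def cinner_sum_e)

lemma diag_op_basis: "(e n, of_real (d n) *\<^sub>C e n) \<in> diag_op e d"
  by (simp add: diag_op_def cinner_scaleC_left orthonormal)

lemma diag_op_symmetric:
  assumes "(x, y) \<in> diag_op e d" "(u, v) \<in> diag_op e d"
  shows "cinner y u = cinner x v"
proof (rule sums_unique2[OF parseval])
  show "(\<lambda>n. cinner y (e n) * cnj (cinner u (e n))) sums cinner x v"
    using parseval[of x v] by (simp add: diag_opD[OF assms(1)] diag_opD[OF assms(2)] mult_ac)
qed

text \<open>Partial sums of expansions lie in the domain, so it is dense; testing an adjoint pair
  against the basis vectors returns the coefficient relation, so the adjoint is no larger.\<close>

lemma selfadjoint_diag_op: "selfadjoint_op (diag_op e d)"
proof -
  have "closure (Domain (diag_op e d)) = UNIV"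
  proof (rule set_eqI, simp add: closure_sequential, intro exI conjI allI)
    fix x
    show "(\<lambda>N. \<Sum>n<N. cinner x (e n) *\<^sub>C e n) \<longlonglongrightarrow> x"
      by (rule expansion)
    show "(\<Sum>n<N. cinner x (e n) *\<^sub>C e n) \<in> Domain (diag_op e d)" for N
      by (rule DomainI[OF diag_op_sum]) simp
  qed
  moreover have "(v, w) \<in> diag_op e d" if "(v, w) \<in> adjoint_op (diag_op e d)" for v w
  proof -
    have "cinner w (e n) = of_real (d n) * cinner v (e n)" for n
    proof -
      have "of_real (d n) * cinner (e n) v = cinner (e n) w"
        using adjoint_opD[OF that diag_op_basis] by (simp add: cinner_scaleC_left)
      then show ?thesis
        using cinner_commute by (metis complex_cnj_complex_of_real complex_cnj_mult)
    qed
    then show ?thesis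
      by (simp add: diag_op_def)
  qed
  moreover have "diag_op e d \<subseteq> adjoint_op (diag_op e d)"
    unfolding adjoint_op_def using diag_op_symmetric by fastforce
  ultimately show ?thesis
    unfolding selfadjoint_op_def by auto
qed

lemma nonneg_diag_op:
  assumes "\<And>n. d n \<ge> 0"
  shows "nonneg_op (diag_op e d)"
  unfolding nonneg_op_def
proof clarify
  fix x y assume xy: "(x, y) \<in> diag_op e d"
  show "Re (cinner y x) \<ge> 0"
  proof (rule sums_le[OF _ sums_zero sums_Re[OF parseval]])
    fix n
    show "0 \<le> Re (cinner y (e n) * cnj (cinner x (e n)))"
      unfolding diag_opD[OF xy] mult.assoc complex_norm_square[symmetric]
      using assms[of n] by simp
  qed
qed

text \<open>The intermediate vector must be shown to exist: each term |s c|^2 equals |s^2 c| |c|,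
  which is at most |s^2 c|^2 + |c|^2, so its coefficients are square summable.\<close>

lemma diag_op_comp: "diag_op e s O diag_op e s = diag_op e (\<lambda>n. (s n)\<^sup>2)"
proof (intro equalityI subrelI)
  show "(x, z) \<in> diag_op e (\<lambda>n. (s n)\<^sup>2)" if "(x, z) \<in> diag_op e s O diag_op e s" for x z
    using that by (auto simp: diag_op_def power2_eq_square)
next
  fix x z assume xz: "(x, z) \<in> diag_op e (\<lambda>n. (s n)\<^sup>2)"
  have "(\<Sum>n<N. (cmod (of_real (s n) * cinner x (e n)))\<^sup>2) \<le> (norm z)\<^sup>2 + (norm x)\<^sup>2" for N
  proof -
    have "(cmod (of_real (s n) * cinner x (e n)))\<^sup>2
        \<le> (cmod (cinner z (e n)))\<^sup>2 + (cmod (cinner x (e n)))\<^sup>2" for n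
    proof -
      have "(cmod (of_real (s n) * cinner x (e n)))\<^sup>2
          = cmod (cinner z (e n)) * cmod (cinner x (e n))"
        by (simp add: diag_opD[OF xz] norm_mult power2_eq_square norm_power)
      also have "\<dots> \<le> (cmod (cinner z (e n)))\<^sup>2 + (cmod (cinner x (e n)))\<^sup>2"
        using sum_squares_bound[of "cmod (cinner z (e n))" "cmod (cinner x (e n))"]
          mult_nonneg_nonneg[OF norm_ge_zero norm_ge_zero, of "cinner z (e n)" "cinner x (e n)"]
        by linarith
      finally show ?thesis .
    qed
    then have "(\<Sum>n<N. (cmod (of_real (s n) * cinner x (e n)))\<^sup>2)
        \<le> (\<Sum>n<N. (cmod (cinner z (e n)))\<^sup>2) + (\<Sum>n<N. (cmod (cinner x (e n)))\<^sup>2)"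
      unfolding sum.distrib[symmetric] by (intro sum_mono) simp
    also have "\<dots> \<le> (norm z)\<^sup>2 + (norm x)\<^sup>2"
      by (intro add_mono bessel) simp_all
    finally show ?thesis .
  qed
  from riesz_fischer[OF this] obtain y where "\<And>n. cinner y (e n) = of_real (s n) * cinner x (e n)"
    by metis
  with xz have "(x, y) \<in> diag_op e s" "(y, z) \<in> diag_op e s"
    by (simp_all add: diag_op_def power2_eq_square)
  then show "(x, z) \<in> diag_op e s O diag_op e s"
    by blast
qed

text \<open>A competing root \<open>S\<close> is first evaluated on the basis. Its symmetry then
  places it inside \<open>diag_op e s\<close>, and a selfadjoint operator has no proper symmetric
  extension.\<close>

lemma sqrt_diag_op:
  assumes "\<And>n. s n > 0"
  shows "sqrt_op (diag_op e (\<lambda>n. (s n)\<^sup>2)) = diag_op e s"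
  unfolding sqrt_op_def
proof (rule the_equality)
  show "selfadjoint_op (diag_op e s) \<and> nonneg_op (diag_op e s)
      \<and> diag_op e s O diag_op e s = diag_op e (\<lambda>n. (s n)\<^sup>2)"
    using assms by (simp add: selfadjoint_diag_op nonneg_diag_op diag_op_comp less_imp_le)
next
  fix S assume S: "selfadjoint_op S \<and> nonneg_op S \<and> S O S = diag_op e (\<lambda>n. (s n)\<^sup>2)"
  then have adj: "adjoint_op S = S"
    by (simp add: selfadjoint_op_def)
  have Se: "(e n, of_real (s n) *\<^sub>C e n) \<in> S" for n
  proof -
    have "(e n, of_real ((s n)\<^sup>2) *\<^sub>C e n) \<in> S O S"
      using S diag_op_basis[of n "\<lambda>n. (s n)\<^sup>2"] by simp
    then obtain y where y: "(e n, y) \<in> S" "(y, of_real ((s n)\<^sup>2) *\<^sub>C e n) \<in> S"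
      by blast
    \<comment> \<open>With \<open>y\<close> a value of \<open>S\<close> at \<open>e n\<close>, the
      operator \<open>S\<close> sends \<open>?z\<close> to \<open>- s n\<close> times
      \<open>?z\<close>, which nonnegativity permits only if \<open>?z\<close> is zero. Linearity of
      \<open>S\<close> comes from its being an adjoint.\<close>
    let ?z = "y - of_real (s n) *\<^sub>C e n"
    have "(?z, of_real ((s n)\<^sup>2) *\<^sub>C e n - of_real (s n) *\<^sub>C y) \<in> S"
      using adjoint_op_diff[of _ _ S, unfolded adj, OF y(2) adjoint_op_scaleC[of _ _ S, unfolded adj, OF y(1)]] .
    also have "of_real ((s n)\<^sup>2) *\<^sub>C e n - of_real (s n) *\<^sub>C y = - (s n *\<^sub>R ?z)"
      by (simp add: scaleC_of_real power2_eq_square algebra_simps flip: of_real_mult)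
    finally have "Re (cinner (- (s n *\<^sub>R ?z)) ?z) \<ge> 0"
      using S by (fastforce simp: nonneg_op_def)
    then have "s n * (norm ?z)\<^sup>2 \<le> 0"
      by (simp add: cinner.minus_left cinner.scaleR_left cinner_self flip: of_real_power)
    then have "?z = 0"
      using assms[of n] by (simp add: mult_le_0_iff)
    then show ?thesis
      using y(1) by simp
  qed
  have sub: "S \<subseteq> diag_op e s"
  proof (rule subrelI)
    fix x y assume "(x, y) \<in> S"
    then have "cinner (of_real (s n) *\<^sub>C e n) x = cinner (e n) y" for n
      using adjoint_opD[of x y S, OF _ Se] by (simp add: adj)
    then have "of_real (s n) * cinner (e n) x = cinner (e n) y" for n
      by (simp add: cinner_scaleC_left)
    then have "cinner y (e n) = of_real (s n) * cinner x (e n)" for n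
      using cinner_commute by (metis complex_cnj_complex_of_real complex_cnj_mult)
    then show "(x, y) \<in> diag_op e s"
      by (simp add: diag_op_def)
  qed
  moreover have "diag_op e s \<subseteq> adjoint_op S"
    unfolding adjoint_op_def using diag_op_symmetric sub by fastforce
  ultimately show "S = diag_op e s"
    using adj by blast
qed

text \<open>Coefficients of an eigenvector vanish off the fibre of the eigenvalue. As the fibre is
  finite, the remaining expansion is a finite sum and the algebraic span suffices.\<close>

lemma cdim_eigenspace_diag_op:
  assumes fin: "finite {n. s n = \<mu>}"
  shows "cdim (eigenspace (diag_op e s) (of_real \<mu>)) = card {n. s n = \<mu>}"
proof -
  let ?F = "{n. s n = \<mu>}"
  have inj: "inj_on e ?F"
    by (metis inj_onI orthonormal zero_neq_one)
  have ind: "complex_vector.independent (e ` ?F)"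
    unfolding complex_vector.dependent_finite[OF finite_imageI[OF fin]]
  proof (rule notI, elim exE conjE bexE imageE)
    fix u v n assume u: "(\<Sum>v\<in>e ` ?F. u v *\<^sub>C v) = 0" and n: "u v \<noteq> 0" "v = e n" "n \<in> ?F"
    have "cinner (\<Sum>k\<in>?F. u (e k) *\<^sub>C e k) (e n) = 0"
      using u by (simp add: sum.reindex[OF inj] cinner.zero_left)
    then show False
      using n by (simp add: cinner_sum_e[OF fin])
  qed
  have "eigenspace (diag_op e s) (of_real \<mu>) = cspan (e ` ?F)"
  proof (intro equalityI subsetI)
    fix x assume "x \<in> eigenspace (diag_op e s) (of_real \<mu>)"
    then have "of_real \<mu> * cinner x (e n) = of_real (s n) * cinner x (e n)" for n
      by (simp add: eigenspace_def diag_op_def cinner_scaleC_left)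
    then have "cinner x (e n) = 0" if "s n \<noteq> \<mu>" for n
      using that by (metis mult_cancel_right of_real_eq_iff)
    then have "(\<Sum>n\<in>?F. cinner x (e n) *\<^sub>C e n) = x"
      by (intro eqI) (simp add: cinner_sum_e[OF fin])
    moreover have "(\<Sum>n\<in>?F. cinner x (e n) *\<^sub>C e n) \<in> cspan (e ` ?F)"
      by (intro complex_vector.span_sum complex_vector.span_scale complex_vector.span_base imageI)
    ultimately show "x \<in> cspan (e ` ?F)"
      by simp
  next
    have "csubspace (eigenspace (diag_op e s) (of_real \<mu>))"
      by (simp add: complex_vector.subspace_def eigenspace_def diag_op_def cinner_scaleC_left
          cinner_add_left cinner.zero_left algebra_simps) (metis add_0)
    moreover have "e ` ?F \<subseteq> eigenspace (diag_op e s) (of_real \<mu>)"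
      using diag_op_basis[of _ s] by (auto simp: eigenspace_def)
    ultimately show "x \<in> eigenspace (diag_op e s) (of_real \<mu>)" if "x \<in> cspan (e ` ?F)" for x
      using that complex_vector.span_minimal by blast
  qed
  then show ?thesis
    by (simp add: complex_vector.dim_eq_card_independent[OF ind] card_image[OF inj])
qed

end

text \<open>At the first disagreement, say t n < s n, the value s n is positive and is attained by
  \<open>t\<close> only before \<open>n\<close>, where the sequences agree; \<open>s\<close> attains
  it once more, at \<open>n\<close>. The fibre over 0, possibly infinite, is never counted.\<close>

lemma decreasing_sequence_determined_by_fibres:
  fixes s t :: "nat \<Rightarrow> real"
  assumes "decseq s" "\<And>n. s n \<ge> 0" "decseq t" "\<And>n. t n \<ge> 0"
    and fin: "\<And>\<mu>. \<mu> > 0 \<Longrightarrow> finite {n. s n = \<mu>}" "\<And>\<mu>. \<mu> > 0 \<Longrightarrow> finite {n. t n = \<mu>}"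
    and eq: "\<And>\<mu>. \<mu> > 0 \<Longrightarrow> card {n. s n = \<mu>} = card {n. t n = \<mu>}"
  shows "s = t"
proof
  have not_less: "\<not> t n < s n"
    if "decseq t" "\<And>n. t n \<ge> 0" "\<And>\<mu>. \<mu> > 0 \<Longrightarrow> finite {n. s n = \<mu>}"
      "\<And>\<mu>. \<mu> > 0 \<Longrightarrow> card {n. s n = \<mu>} = card {n. t n = \<mu>}" "\<And>i. i < n \<Longrightarrow> s i = t i"
    for s t :: "nat \<Rightarrow> real" and n
  proof
    assume less: "t n < s n"
    then have pos: "s n > 0"
      using that(2)[of n] by linarith
    have "i < n" if "t i = s n" for i
      using that less decseqD[OF \<open>decseq t\<close>, of n i] by force
    then have "{i. t i = s n} \<subseteq> {i. s i = s n} - {n}"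
      using that(5) by force
    then have "{i. t i = s n} \<subset> {i. s i = s n}"
      by blast
    then have "card {i. t i = s n} < card {i. s i = s n}"
      using that(3)[OF pos] psubset_card_mono by blast
    then show False
      using that(4)[OF pos] by simp
  qed
  fix n show "s n = t n"
  proof (induction n rule: less_induct)
    case (less n)
    show ?case
      using not_less[of t s n] not_less[of s t n] assms less by force
  qed
qed

text \<open>Convergence to 0 makes the fibres over positive values finite, and counting fibres
  leaves only one candidate for the definite description.\<close>

lemma singular_number_eqI:
  assumes "onb f" and mod: "modulus_op A = diag_op f s"
    and s: "decseq s" "\<And>n. s n > 0" "s \<longlonglongrightarrow> 0"
  shows "singular_number A = s"
proof -
  interpret onb f by fact
  have fin: "finite {n. s n = \<mu>}" if "\<mu> > 0" for \<mu>
  proof -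
    have "\<forall>\<^sub>F n in sequentially. s n < \<mu>"
      using order_tendstoD(2)[OF s(3) that] .
    then obtain N where "\<And>n. n \<ge> N \<Longrightarrow> s n < \<mu>"
      by (auto simp: eventually_sequentially)
    then have "{n. s n = \<mu>} \<subseteq> {..<N}"
      by (metis (mono_tags, lifting) lessThan_iff less_irrefl linorder_not_less mem_Collect_eq subsetI)
    then show ?thesis
      using finite_subset by blast
  qed
  show ?thesis
    unfolding singular_number_def mod
  proof (rule the_equality)
    show "decseq s \<and> (\<forall>n. s n \<ge> 0) \<and> (\<forall>\<mu>>0. finite {n. s n = \<mu>} \<and>
        card {n. s n = \<mu>} = cdim (eigenspace (diag_op f s) (of_real \<mu>)))"
      using s fin by (simp add: cdim_eigenspace_diag_op less_imp_le)
    fix t assume "decseq t \<and> (\<forall>n. t n \<ge> 0) \<and> (\<forall>\<mu>>0. finite {n. t n = \<mu>} \<and>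
        card {n. t n = \<mu>} = cdim (eigenspace (diag_op f s) (of_real \<mu>)))"
    then show "t = s"
      using s fin by (intro decreasing_sequence_determined_by_fibres)
        (simp_all add: cdim_eigenspace_diag_op less_imp_le)
  qed
qed

section \<open>The spectral theorem for positive compact operators\<close>

definition clinear_op :: "('a :: complex_inner \<Rightarrow> 'a) \<Rightarrow> bool" where
  "clinear_op T \<longleftrightarrow> bounded_linear T \<and> (\<forall>c x. T (c *\<^sub>C x) = c *\<^sub>C T x)"

definition compact_op :: "('a :: complex_inner \<Rightarrow> 'a) \<Rightarrow> bool" where
  "compact_op T \<longleftrightarrow> (\<forall>X. bounded (range X) \<longrightarrow>
     (\<exists>z r. strict_mono (r :: nat \<Rightarrow> nat) \<and> (\<lambda>k. T (X (r k))) \<longlonglongrightarrow> z))"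

text \<open>Strict positivity excludes a kernel, so that eigenvectors to positive eigenvalues can
  exhaust the space.\<close>

locale positive_compact =
  fixes T :: "'a :: chilbert_space \<Rightarrow> 'a"
  assumes clinear: "clinear_op T" and compact: "compact_op T"
    and symmetric: "cinner (T x) y = cinner x (T y)"
    and positive: "x \<noteq> 0 \<Longrightarrow> Re (cinner (T x) x) > 0"
begin

lemma bounded_linear: "bounded_linear T"
  using clinear by (simp add: clinear_op_def)

lemma T_scaleC: "T (c *\<^sub>C x) = c *\<^sub>C T x"
  using clinear by (simp add: clinear_op_def)

sublocale T: bounded_linear T
  by (rule bounded_linear)

lemma nonneg: "Re (cinner (T x) x) \<ge> 0"
  using positive[of x] by (cases "x = 0") (auto simp: cinner.zero_right)

text \<open>The quadratic form is maximised on the unit sphere of the invariant subspace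
  \<open>V\<close>; a maximising sequence consists of approximate eigenvectors, and compactness
  makes a subsequence converge.\<close>

lemma top_eigenvector:
  assumes V: "closed V" "csubspace V" "\<And>x. x \<in> V \<Longrightarrow> T x \<in> V" and v: "v \<in> V" "v \<noteq> 0"
  shows "\<exists>f\<in>V. norm f = 1 \<and> (\<exists>\<tau>>0. T f = of_real \<tau> *\<^sub>C f \<and>
    (\<forall>x\<in>V. Re (cinner (T x) x) \<le> \<tau> * (norm x)\<^sup>2))"
proof -
  define q where "q x = Re (cinner (T x) x)" for x
  have V_R: "r *\<^sub>R x \<in> V" if "x \<in> V" for r x
    using that V(2) by (metis complex_vector.subspace_scale scaleR_scaleC)
  have q_scale: "q (r *\<^sub>R x) = r\<^sup>2 * q x" for r x
    by (simp add: q_def T.scaleR cinner.scaleR_left cinner.scaleR_right power2_eq_square)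
  define Q where "Q = q ` {x \<in> V. norm x = 1}"
  define \<tau> where "\<tau> = Sup Q"
  have "bdd_above Q"
  proof (rule bdd_aboveI)
    fix y assume "y \<in> Q"
    then obtain x where x: "norm x = 1" "y = q x"
      by (auto simp: Q_def)
    have "q x \<le> norm (T x) * norm x"
      using complex_Re_le_cmod cmod_cinner_le order_trans unfolding q_def by blast
    also have "\<dots> \<le> onorm T"
      using onorm[OF bounded_linear, of x] x by simp
    finally show "y \<le> onorm T"
      using x by simp
  qed
  have le_\<tau>: "q x \<le> \<tau> * (norm x)\<^sup>2" if "x \<in> V" for x
  proof (cases "x = 0")
    case True
    then show ?thesis
      by (simp add: q_def cinner.zero_right)
  next
    case False
    have "q ((1 / norm x) *\<^sub>R x) \<in> Q"
      using V_R[OF that] False by (auto simp: Q_def)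
    then have "q ((1 / norm x) *\<^sub>R x) \<le> \<tau>"
      unfolding \<tau>_def using \<open>bdd_above Q\<close> by (rule cSup_upper)
    then show ?thesis
      using False by (simp add: q_scale field_simps)
  qed
  have "0 < \<tau> * (norm v)\<^sup>2"
    using le_\<tau>[OF v(1)] positive[OF v(2)] by (simp add: q_def)
  then have "\<tau> > 0"
    by (simp add: zero_less_mult_iff)
  have normT: "(norm (T x))\<^sup>2 \<le> \<tau> * q x" if "x \<in> V" for x
  proof -
    \<comment> \<open>Nonnegativity of \<open>q\<close> at \<open>x - ?y\<close>, combined with the
      bound of \<open>q ?y\<close> by \<open>\<tau>\<close>, replaces Cauchy-Schwarz for the
      semi-inner product of \<open>T\<close>.\<close>
    let ?y = "(1 / \<tau>) *\<^sub>R T x"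
    have "0 \<le> q (x - ?y)"
      unfolding q_def by (rule nonneg)
    also have "q (x - ?y) = q x + q ?y - 2 * Re (cinner (T x) ?y)"
      using symmetric[of "?y" x] cinner_commute[of ?y "T x"]
      by (simp add: q_def T.diff cinner.diff_left cinner.diff_right)
    also have "Re (cinner (T x) ?y) = (norm (T x))\<^sup>2 / \<tau>"
      by (simp add: cinner.scaleR_right cinner_self flip: of_real_power)
    also have "q ?y \<le> \<tau> * (norm ?y)\<^sup>2"
      by (intro le_\<tau> V_R V that)
    also have "\<tau> * (norm ?y)\<^sup>2 = (norm (T x))\<^sup>2 / \<tau>"
      using \<open>\<tau> > 0\<close> by (simp add: power2_eq_square field_simps)
    finally have "(norm (T x))\<^sup>2 / \<tau> \<le> q x"
      by simp
    then show ?thesis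
      using \<open>\<tau> > 0\<close> by (simp add: field_simps)
  qed
  have "\<exists>x. x \<in> V \<and> norm x = 1 \<and> q x > \<tau> - 1 / real (Suc k)" for k
  proof -
    have "Q \<noteq> {}"
      using V_R[OF v(1), of "1 / norm v"] v(2) unfolding Q_def image_is_empty
      by (intro notI) (drule equals0D[of _ "(1 / norm v) *\<^sub>R v"], simp)
    then obtain y where "y \<in> Q" "\<tau> - 1 / real (Suc k) < y"
      using less_cSupD[of Q "\<tau> - 1 / real (Suc k)"] by (auto simp: \<tau>_def)
    then show ?thesis
      by (auto simp: Q_def)
  qed
  then obtain X where X: "\<And>k. X k \<in> V" "\<And>k. norm (X k) = 1"
    "\<And>k. q (X k) > \<tau> - 1 / real (Suc k)"
    by metis
  have "bounded (range X)"
    by (rule boundedI[of _ 1]) (use X in auto)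
  then obtain z r where r: "strict_mono r" and z: "(\<lambda>k. T (X (r k))) \<longlonglongrightarrow> z"
    using compact unfolding compact_op_def by blast
  \<comment> \<open>Expanding the square and inserting \<open>normT\<close> leaves
    \<open>\<tau> * (\<tau> - q (X k))\<close>, which tends to 0 along the maximising
    sequence.\<close>
  have "(\<lambda>k. T (X k) - \<tau> *\<^sub>R X k) \<longlonglongrightarrow> 0"
  proof (rule Lim_null_comparison)
    have "(norm (T (X k) - \<tau> *\<^sub>R X k))\<^sup>2 \<le> \<tau> / real (Suc k)" for k
    proof -
      have "(norm (T (X k) - \<tau> *\<^sub>R X k))\<^sup>2 = (norm (T (X k)))\<^sup>2 + \<tau>\<^sup>2 - 2 * \<tau> * q (X k)"
        using norm_add_sq[of "T (X k)" "- (\<tau> *\<^sub>R X k)"] X(2)[of k]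
        by (simp add: cinner.minus_right cinner.scaleR_right q_def)
      also have "\<dots> \<le> \<tau> * (\<tau> - q (X k))"
        using normT[OF X(1), of k] by (simp add: power2_eq_square algebra_simps)
      also have "\<dots> \<le> \<tau> * (1 / real (Suc k))"
        using X(3)[of k] \<open>\<tau> > 0\<close> by (intro mult_left_mono) linarith+
      finally show ?thesis by simp
    qed
    then show "\<forall>\<^sub>F k in sequentially. norm (T (X k) - \<tau> *\<^sub>R X k) \<le> sqrt (\<tau> / real (Suc k))"
      by (intro always_eventually allI real_le_rsqrt)
    have "(\<lambda>k. sqrt (\<tau> * inverse (real (Suc k)))) \<longlonglongrightarrow> sqrt (\<tau> * 0)"
      by (intro tendsto_intros LIMSEQ_inverse_real_of_nat)
    then show "(\<lambda>k. sqrt (\<tau> / real (Suc k))) \<longlonglongrightarrow> 0"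
      by (simp add: divide_inverse)
  qed
  then have "(\<lambda>k. T (X (r k)) - \<tau> *\<^sub>R X (r k)) \<longlonglongrightarrow> 0"
    using LIMSEQ_subseq_LIMSEQ[OF _ r, of "\<lambda>k. T (X k) - \<tau> *\<^sub>R X k" 0] by (simp add: o_def)
  \<comment> \<open>Convergence passes from the images to the vectors themselves, because
    \<open>\<tau>\<close> is nonzero.\<close>
  from tendsto_diff[OF z this] have "(\<lambda>k. \<tau> *\<^sub>R X (r k)) \<longlonglongrightarrow> z"
    by simp
  from tendsto_scaleR[OF tendsto_const[of "1 / \<tau>"] this]
  have lim: "(\<lambda>k. X (r k)) \<longlonglongrightarrow> (1 / \<tau>) *\<^sub>R z"
    using \<open>\<tau> > 0\<close> by simp
  let ?f = "(1 / \<tau>) *\<^sub>R z"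
  have "?f \<in> V"
    using closed_sequentially[OF V(1) _ lim] X(1) by blast
  moreover have "norm ?f = 1"
    by (rule LIMSEQ_unique[OF tendsto_norm[OF lim]]) (simp add: X(2))
  moreover have "T ?f = of_real \<tau> *\<^sub>C ?f"
    using LIMSEQ_unique[OF T.tendsto[OF lim] z] \<open>\<tau> > 0\<close> by (simp add: scaleC_of_real)
  ultimately show ?thesis
    using \<open>\<tau> > 0\<close> le_\<tau> unfolding q_def by blast
qed

text \<open>Top eigenvectors are chosen recursively on the orthogonal complements of the earlier
  ones. The sequence \<open>e\<close> certifies infinite dimension, which keeps these complements
  nonzero.\<close>

lemma spectral_theorem:
  assumes "orthonormal (e :: nat \<Rightarrow> 'a)"
  shows "\<exists>f \<tau>. onb f \<and> (\<forall>n. \<tau> n > 0) \<and> decseq \<tau> \<and> \<tau> \<longlonglongrightarrow> 0 \<and>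
    (\<forall>n. T (f n) = of_real (\<tau> n) *\<^sub>C f n) \<and>
    (\<forall>n x. (\<forall>i<n. cinner x (f i) = 0) \<longrightarrow> Re (cinner (T x) x) \<le> \<tau> n * (norm x)\<^sup>2)"
proof -
  interpret e: orthonormal e by fact
  define P where "P f n x \<longleftrightarrow> norm x = 1 \<and> (\<forall>i<n. cinner x (f i) = 0) \<and>
    (\<exists>t>0. T x = of_real t *\<^sub>C x \<and>
      (\<forall>y. (\<forall>i<n. cinner y (f i) = 0) \<longrightarrow> Re (cinner (T y) y) \<le> t * (norm y)\<^sup>2))" for f x and n :: nat
  have "\<exists>f. \<forall>n. P f n (f n)"
  proof (rule dependent_wellorder_choice)
    show "P f n x = P g n x" if "\<And>m. m < n \<Longrightarrow> f m = g m" for f g n x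
      using that by (simp add: P_def)
    fix n f assume f: "\<And>m. m < n \<Longrightarrow> P f m (f m)"
    define V where "V = {x. \<forall>i<n. cinner x (f i) = 0}"
    have "V = (\<Inter>i<n. {x. cinner x (f i) = 0})"
      by (auto simp: V_def)
    moreover have "closed {x. cinner x y = 0}" for y :: 'a
      by (intro closed_Collect_eq linear_continuous_on cinner.bounded_linear_left continuous_on_const)
    ultimately have "closed V"
      by auto
    moreover have "csubspace V"
      by (simp add: V_def complex_vector.subspace_def cinner.zero_left cinner_add_left
          cinner_scaleC_left)
    moreover have "T x \<in> V" if "x \<in> V" for x
    proof -
      have "cinner (T x) (f i) = 0" if i: "i < n" for i
      proof -
        obtain t where "T (f i) = of_real t *\<^sub>C f i"
          using f[OF i] by (auto simp: P_def)
        then show ?thesis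
          using \<open>x \<in> V\<close> i by (simp add: symmetric V_def cinner_scaleC_right)
      qed
      then show ?thesis
        by (simp add: V_def)
    qed
    moreover obtain v where "v \<in> V" "v \<noteq> 0"
    proof -
      obtain c v where v: "v = (\<Sum>j\<le>n. c j *\<^sub>C e j)" "v \<noteq> 0"
        and "\<And>i. i < n \<Longrightarrow> (\<Sum>j\<le>n. c j * cinner (e j) (f i)) = 0"
        using e.orthogonal_vector_in_span[of n "\<lambda>x. x" f] by metis
      then have "v \<in> V"
        by (simp add: V_def cinner.sum_left cinner_scaleC_left)
      then show thesis
        using that v(2) by blast
    qed
    ultimately show "\<exists>x. P f n x"
      using top_eigenvector[of V v] unfolding P_def by (auto simp: V_def)
  qed
  then obtain f where f: "\<And>n. P f n (f n)"
    by blast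
  have "\<exists>\<tau>. \<forall>n. \<tau> n > 0 \<and> T (f n) = of_real (\<tau> n) *\<^sub>C f n \<and>
      (\<forall>y. (\<forall>i<n. cinner y (f i) = 0) \<longrightarrow> Re (cinner (T y) y) \<le> \<tau> n * (norm y)\<^sup>2)"
    using f unfolding P_def by (intro choice allI) blast
  then obtain \<tau> where \<tau>: "\<And>n. \<tau> n > 0" "\<And>n. T (f n) = of_real (\<tau> n) *\<^sub>C f n"
    "\<And>n y. (\<And>i. i < n \<Longrightarrow> cinner y (f i) = 0) \<Longrightarrow> Re (cinner (T y) y) \<le> \<tau> n * (norm y)\<^sup>2"
    by blast
  have norm_f: "norm (f n) = 1" for n
    using f by (simp add: P_def)
  have orth: "cinner (f m) (f n) = 0" if "m \<noteq> n" for m n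
    using that f[of m] f[of n] cinner_eq_0_iff_commute unfolding P_def
    by (metis linorder_neqE_nat)
  interpret f: orthonormal f
    by unfold_locales (auto simp: orth cinner_self norm_f)
  have Re_T: "Re (cinner (T (f n)) (f n)) = \<tau> n" for n
    by (simp add: \<tau>(2) cinner_scaleC_left f.orthonormal)
  have dec: "decseq \<tau>"
  proof (rule decseq_SucI)
    fix n
    have "\<tau> (Suc n) = Re (cinner (T (f (Suc n))) (f (Suc n)))"
      by (simp add: Re_T)
    also have "\<dots> \<le> \<tau> n * (norm (f (Suc n)))\<^sup>2"
      by (rule \<tau>(3)) (simp add: orth)
    finally show "\<tau> (Suc n) \<le> \<tau> n"
      by (simp add: norm_f)
  qed
  have lim: "\<tau> \<longlonglongrightarrow> 0"
  proof -
    have "bounded (range f)"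
      by (rule boundedI[of _ 1]) (auto simp: norm_f)
    then obtain z r where r: "strict_mono r" and z: "(\<lambda>k. T (f (r k))) \<longlonglongrightarrow> z"
      using compact unfolding compact_op_def by blast
    \<comment> \<open>Images of two different eigenvectors are at least an eigenvalue apart, while
      consecutive terms of a convergent subsequence approach each other.\<close>
    have le: "\<tau> (r (Suc k)) \<le> norm (T (f (r k)) - T (f (r (Suc k))))" for k
    proof -
      have "r k \<noteq> r (Suc k)"
        using r by (simp add: strict_mono_eq)
      then have "cinner (T (f (r k)) - T (f (r (Suc k)))) (f (r (Suc k))) = - of_real (\<tau> (r (Suc k)))"
        by (simp add: \<tau>(2) cinner.diff_left cinner_scaleC_left f.orthonormal)
      then have "cmod (cinner (T (f (r k)) - T (f (r (Suc k)))) (f (r (Suc k)))) = \<tau> (r (Suc k))"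
        using \<tau>(1)[of "r (Suc k)"] by simp
      then show ?thesis
        using cmod_cinner_le[of "T (f (r k)) - T (f (r (Suc k)))" "f (r (Suc k))"]
        by (simp add: norm_f)
    qed
    have "(\<lambda>k. norm (T (f (r k)) - T (f (r (Suc k))))) \<longlonglongrightarrow> norm (z - z)"
      by (intro tendsto_norm tendsto_diff z LIMSEQ_Suc[OF z])
    then have "(\<lambda>k. norm (T (f (r k)) - T (f (r (Suc k))))) \<longlonglongrightarrow> 0"
      by simp
    then have sub: "(\<lambda>k. \<tau> (r (Suc k))) \<longlonglongrightarrow> 0"
      by (rule Lim_null_comparison[rotated]) (use le \<tau>(1) in \<open>simp add: abs_of_pos\<close>)
    obtain l where "\<tau> \<longlonglongrightarrow> l"
      using decseq_convergent[OF dec, of 0] \<tau>(1) less_imp_le by metis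
    moreover from this have "(\<lambda>k. \<tau> (r (Suc k))) \<longlonglongrightarrow> l"
      using LIMSEQ_Suc[OF LIMSEQ_subseq_LIMSEQ[OF _ r]] by (simp add: o_def)
    ultimately show ?thesis
      using LIMSEQ_unique[OF sub] by blast
  qed
  \<comment> \<open>A vector orthogonal to all \<open>f n\<close> has form value at most
    \<open>\<tau> n * (norm x)\<^sup>2\<close> for every \<open>n\<close>, hence at most 0, and
    strict positivity makes it zero.\<close>
  have "onb f"
  proof
    fix x assume "\<And>n. cinner x (f n) = 0"
    then have "Re (cinner (T x) x) \<le> \<tau> n * (norm x)\<^sup>2" for n
      by (intro \<tau>(3)) simp
    moreover have "(\<lambda>n. \<tau> n * (norm x)\<^sup>2) \<longlonglongrightarrow> 0 * (norm x)\<^sup>2"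
      by (intro tendsto_mult lim tendsto_const)
    ultimately have "Re (cinner (T x) x) \<le> 0"
      using LIMSEQ_le_const by fastforce
    then show "x = 0"
      using positive[of x] by force
  qed
  then show ?thesis
    using \<tau> dec lim by (intro exI[of _ f] exI[of _ \<tau>]) simp
qed

end

section \<open>The closed form and its real part\<close>

locale coercive_form =
  fixes Hp M :: "'a :: chilbert_space set"
    and ip :: "'a \<Rightarrow> 'a \<Rightarrow> complex"
    and L :: "'a \<Rightarrow> 'a"
    and C0 C1 C2 :: real
  assumes hilbert: "hilbert_on Hp ip"
    and C0: "C0 > 0" and norm_le: "f \<in> Hp \<Longrightarrow> norm f \<le> C0 * ip_norm ip f"
    and compact_ball: "compact (closure {f \<in> Hp. ip_norm ip f \<le> 1})"
    and M_subspace: "csubspace M" and M_sub: "M \<subseteq> Hp"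
    and dense: "f \<in> Hp \<Longrightarrow> \<epsilon> > 0 \<Longrightarrow> \<exists>g\<in>M. ip_norm ip (f - g) < \<epsilon>"
    and L_add: "f \<in> M \<Longrightarrow> g \<in> M \<Longrightarrow> L (f + g) = L f + L g"
    and L_scaleC: "f \<in> M \<Longrightarrow> L (c *\<^sub>C f) = c *\<^sub>C L f"
    and C1: "C1 > 0"
    and L_le: "f \<in> M \<Longrightarrow> g \<in> M \<Longrightarrow> cmod (cinner (L f) g) \<le> C1 * ip_norm ip f * ip_norm ip g"
    and C2: "C2 > 0"
    and L_ge: "f \<in> M \<Longrightarrow> Re (cinner (L f) f) \<ge> C2 * (ip_norm ip f)\<^sup>2"
begin

abbreviation "N \<equiv> ip_norm ip"
abbreviation "t \<equiv> \<lambda>f g. cinner (L f) g"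
abbreviation "T \<equiv> form_closure M t"

section \<open>The norm of \<open>Hp\<close>\<close>

lemma Hp_subspace: "csubspace Hp"
  using hilbert unfolding hilbert_on_def by blast

lemma ip_add_left: "x \<in> Hp \<Longrightarrow> y \<in> Hp \<Longrightarrow> z \<in> Hp \<Longrightarrow> ip (x + y) z = ip x z + ip y z"
  using hilbert unfolding hilbert_on_def by blast

lemma ip_scaleC_left: "x \<in> Hp \<Longrightarrow> y \<in> Hp \<Longrightarrow> ip (c *\<^sub>C x) y = c * ip x y"
  using hilbert unfolding hilbert_on_def by blast

lemma ip_commute: "x \<in> Hp \<Longrightarrow> y \<in> Hp \<Longrightarrow> ip x y = cnj (ip y x)"
  using hilbert unfolding hilbert_on_def by blast

lemma ip_pos: "x \<in> Hp \<Longrightarrow> x \<noteq> 0 \<Longrightarrow> Re (ip x x) > 0"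
  using hilbert unfolding hilbert_on_def by blast

lemma Hp_complete:
  assumes "\<And>n. X n \<in> Hp" "\<And>\<epsilon>. \<epsilon> > 0 \<Longrightarrow> \<exists>k. \<forall>m\<ge>k. \<forall>n\<ge>k. N (X m - X n) < \<epsilon>"
  obtains x where "x \<in> Hp" "(\<lambda>n. N (X n - x)) \<longlonglongrightarrow> 0"
  using hilbert assms unfolding hilbert_on_def by blast

lemmas Hp_closed =
  complex_vector.subspace_0[OF Hp_subspace]
  complex_vector.subspace_add[OF Hp_subspace]
  complex_vector.subspace_diff[OF Hp_subspace]
  complex_vector.subspace_scale[OF Hp_subspace]
  complex_vector.subspace_sum[OF Hp_subspace]

lemmas M_closed =
  complex_vector.subspace_0[OF M_subspace]
  complex_vector.subspace_add[OF M_subspace]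
  complex_vector.subspace_diff[OF M_subspace]
  complex_vector.subspace_scale[OF M_subspace]

lemma M_Hp: "f \<in> M \<Longrightarrow> f \<in> Hp"
  using M_sub by blast

lemma ip_zero: "x \<in> Hp \<Longrightarrow> ip 0 x = 0"
  using ip_scaleC_left[of x x 0] by (simp add: scaleC.zero_left)

lemma N_sq: "x \<in> Hp \<Longrightarrow> (N x)\<^sup>2 = Re (ip x x)"
  using ip_pos[of x] ip_zero[of x] unfolding ip_norm_def by (cases "x = 0") auto

lemma N_nonneg: "x \<in> Hp \<Longrightarrow> N x \<ge> 0"
  using ip_pos[of x] ip_zero[of x] unfolding ip_norm_def by (cases "x = 0") auto

lemma N_scaleC: "x \<in> Hp \<Longrightarrow> N (c *\<^sub>C x) = cmod c * N x"
proof -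
  assume x: "x \<in> Hp"
  then have cx: "c *\<^sub>C x \<in> Hp"
    by (intro Hp_closed)
  have "ip (c *\<^sub>C x) (c *\<^sub>C x) = c * cnj c * cnj (ip x x)"
    unfolding ip_scaleC_left[OF x cx] ip_commute[OF x cx] ip_scaleC_left[OF x x] by simp
  then have "Re (ip (c *\<^sub>C x) (c *\<^sub>C x)) = (cmod c)\<^sup>2 * Re (ip x x)"
    unfolding complex_norm_square[symmetric] by simp
  then have "(N (c *\<^sub>C x))\<^sup>2 = (cmod c * N x)\<^sup>2"
    using x cx by (simp add: N_sq power_mult_distrib)
  then show ?thesis
    using power2_eq_imp_eq N_nonneg[OF x] N_nonneg[OF cx] by (metis mult_nonneg_nonneg norm_ge_zero)
qed

lemma N_minus: "x \<in> Hp \<Longrightarrow> N (- x) = N x"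
  using N_scaleC[of x "-1"] unfolding scaleC.minus_left scaleC_one norm_minus_cancel norm_one by simp

lemma N_minus_commute: "x \<in> Hp \<Longrightarrow> y \<in> Hp \<Longrightarrow> N (x - y) = N (y - x)"
  using N_minus[of "x - y"] Hp_closed(3)[of x y] by simp

text \<open>The parallelogram law gives a triangle inequality with constant 2, which suffices for all limits
  below; this is where the factors 2 and 4 in the form bounds come from.\<close>

lemma N_add_sq_le:
  assumes "x \<in> Hp" "y \<in> Hp"
  shows "(N (x + y))\<^sup>2 \<le> 2 * (N x)\<^sup>2 + 2 * (N y)\<^sup>2"
proof -
  have add_right: "ip z (x + y) = ip z x + ip z y" if "z \<in> Hp" "x \<in> Hp" "y \<in> Hp" for x y z
    using ip_commute[OF that(1) Hp_closed(2)[OF that(2,3)]] ip_commute[OF that(1,2)]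
      ip_commute[OF that(1,3)] ip_add_left[OF that(2,3,1)] by simp
  define y' where "y' = (-1) *\<^sub>C y"
  have y': "y' \<in> Hp"
    unfolding y'_def by (intro Hp_closed assms)
  have *: "ip y' z = - ip y z" "ip z y' = - ip z y" if "z \<in> Hp" for z
  proof -
    show "ip y' z = - ip y z"
      using ip_scaleC_left[OF assms(2) that, of "-1"] by (simp add: y'_def)
    then show "ip z y' = - ip z y"
      using ip_commute[OF that y'] ip_commute[OF that assms(2)] by simp
  qed
  have "(N (x + y))\<^sup>2 + (N (x + y'))\<^sup>2 = 2 * (N x)\<^sup>2 + 2 * (N y)\<^sup>2"
    using assms y' by (simp add: N_sq Hp_closed ip_add_left add_right *)
  then show ?thesis
    by (smt (verit) zero_le_power2)
qed

lemma N_add_le: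
  assumes "x \<in> Hp" "y \<in> Hp"
  shows "N (x + y) \<le> 2 * (N x + N y)"
proof (rule power2_le_imp_le)
  have "2 * (N x)\<^sup>2 + 2 * (N y)\<^sup>2 \<le> (2 * (N x + N y))\<^sup>2"
    using mult_nonneg_nonneg[OF N_nonneg N_nonneg, OF assms]
    by (simp add: power2_eq_square algebra_simps)
  with N_add_sq_le[OF assms] show "(N (x + y))\<^sup>2 \<le> (2 * (N x + N y))\<^sup>2"
    by linarith
qed (use assms N_nonneg in simp)

lemma N_diff_le: "x \<in> Hp \<Longrightarrow> y \<in> Hp \<Longrightarrow> N (x - y) \<le> 2 * (N x + N y)"
  using N_add_le[of x "- y"] N_minus[of y] Hp_closed(3)[OF Hp_closed(1), of y] by simp

section \<open>The form closure as a bounded coercive form on \<open>Hp\<close>\<close>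

definition approx :: "(nat \<Rightarrow> 'a) \<Rightarrow> 'a \<Rightarrow> bool" where
  "approx X u \<longleftrightarrow> (\<forall>n. X n \<in> M) \<and> u \<in> Hp \<and> (\<lambda>n. N (X n - u)) \<longlonglongrightarrow> 0"

lemma approx_Hp: "approx X u \<Longrightarrow> X n \<in> Hp" "approx X u \<Longrightarrow> X n \<in> M" "approx X u \<Longrightarrow> u \<in> Hp"
  using M_Hp by (auto simp: approx_def)

lemma approx_lim: "approx X u \<Longrightarrow> (\<lambda>n. N (X n - u)) \<longlonglongrightarrow> 0"
  by (simp add: approx_def)

lemma norm_lim:
  assumes "\<And>n. X n \<in> Hp" "u \<in> Hp" "(\<lambda>n. N (X n - u)) \<longlonglongrightarrow> 0"
  shows "X \<longlonglongrightarrow> u"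
proof -
  have "(\<lambda>n. X n - u) \<longlonglongrightarrow> 0"
  proof (rule Lim_null_comparison)
    show "\<forall>\<^sub>F n in sequentially. norm (X n - u) \<le> C0 * N (X n - u)"
      using assms by (intro always_eventually allI norm_le Hp_closed)
    show "(\<lambda>n. C0 * N (X n - u)) \<longlonglongrightarrow> 0"
      using tendsto_mult[OF tendsto_const assms(3)] by simp
  qed
  then show ?thesis
    by (simp add: LIM_zero_iff)
qed

lemma N_diff_less:
  assumes "\<And>n. X n \<in> Hp" "u \<in> Hp" "(\<lambda>n. N (X n - u)) \<longlonglongrightarrow> 0" "\<epsilon> > 0"
  obtains k where "\<And>m n. m \<ge> k \<Longrightarrow> n \<ge> k \<Longrightarrow> N (X m - X n) < \<epsilon>"
proof -
  \<comment> \<open>A quarter, because the triangle inequality for \<open>N\<close> carries the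
    factor 2.\<close>
  have "\<forall>\<^sub>F n in sequentially. N (X n - u) < \<epsilon> / 4"
    by (rule order_tendstoD(2)[OF assms(3)]) (use assms(4) in simp)
  then obtain k where k: "\<And>n. n \<ge> k \<Longrightarrow> N (X n - u) < \<epsilon> / 4"
    by (auto simp: eventually_sequentially)
  have "N (X m - X n) < \<epsilon>" if "m \<ge> k" "n \<ge> k" for m n
  proof -
    have "N ((X m - u) - (X n - u)) \<le> 2 * (N (X m - u) + N (X n - u))"
      using assms by (intro N_diff_le Hp_closed)
    then show ?thesis
      using k[OF that(1)] k[OF that(2)] by simp
  qed
  then show thesis
    by (rule that)
qed

text \<open>Coercivity turns Cauchy in the form into Cauchy in \<open>N\<close>; completeness of
  \<open>Hp\<close> gives a limit, which the continuous embedding identifies with \<open>u\<close>.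
  The converse is boundedness of the form. Hence Kato's closure can be computed with convergence in
  \<open>Hp\<close>.\<close>

lemma form_converges_iff: "form_converges M t X u \<longleftrightarrow> approx X u"
proof
  assume X: "form_converges M t X u"
  then have M: "X n \<in> M" for n
    by (simp add: form_converges_def)
  have "\<exists>k. \<forall>m\<ge>k. \<forall>n\<ge>k. N (X m - X n) < \<epsilon>" if "\<epsilon> > 0" for \<epsilon>
  proof -
    have "C2 * \<epsilon>\<^sup>2 > 0"
      using C2 that by simp
    then obtain k where k: "\<And>m n. m \<ge> k \<Longrightarrow> n \<ge> k \<Longrightarrow> cmod (t (X m - X n) (X m - X n)) < C2 * \<epsilon>\<^sup>2"
      using X unfolding form_converges_def by blast
    have "N (X m - X n) < \<epsilon>" if mn: "m \<ge> k" "n \<ge> k" for m n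
    proof -
      have "C2 * (N (X m - X n))\<^sup>2 \<le> Re (t (X m - X n) (X m - X n))"
        by (intro L_ge M_closed M)
      also have "\<dots> < C2 * \<epsilon>\<^sup>2"
        using k[OF mn] complex_Re_le_cmod le_less_trans by blast
      finally have "(N (X m - X n))\<^sup>2 < \<epsilon>\<^sup>2"
        using C2 by simp
      then show ?thesis
        using power2_less_imp_less \<open>\<epsilon> > 0\<close> less_imp_le by blast
    qed
    then show ?thesis
      by blast
  qed
  then obtain x where x: "x \<in> Hp" "(\<lambda>n. N (X n - x)) \<longlonglongrightarrow> 0"
    using Hp_complete[of X] M M_Hp by blast
  then have "X \<longlonglongrightarrow> x"
    using M M_Hp x(1) by (intro norm_lim) blast+
  then have "x = u"
    using X LIMSEQ_unique unfolding form_converges_def by blast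
  then show "approx X u"
    using x M by (simp add: approx_def)
next
  assume X: "approx X u"
  note Hp = approx_Hp[OF X] and lim = approx_lim[OF X]
  have "X \<longlonglongrightarrow> u"
    by (rule norm_lim[OF Hp(1) Hp(3) lim])
  moreover have "\<exists>k. \<forall>m\<ge>k. \<forall>n\<ge>k. cmod (t (X m - X n) (X m - X n)) < \<epsilon>" if "\<epsilon> > 0" for \<epsilon>
  proof -
    have "sqrt (\<epsilon> / C1) > 0"
      using that C1 by simp
    then obtain k where k: "\<And>m n. m \<ge> k \<Longrightarrow> n \<ge> k \<Longrightarrow> N (X m - X n) < sqrt (\<epsilon> / C1)"
      using N_diff_less[OF Hp(1) Hp(3) lim] by blast
    have "cmod (t (X m - X n) (X m - X n)) < \<epsilon>" if "m \<ge> k" "n \<ge> k" for m n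
    proof -
      have "cmod (t (X m - X n) (X m - X n)) \<le> C1 * (N (X m - X n))\<^sup>2"
        using L_le[of "X m - X n" "X m - X n"] M_closed(3) Hp(2)
        by (simp add: power2_eq_square mult.assoc)
      also have "(N (X m - X n))\<^sup>2 < (sqrt (\<epsilon> / C1))\<^sup>2"
        by (rule power_strict_mono) (use k[OF that] N_nonneg Hp_closed Hp in auto)
      also have "C1 * (sqrt (\<epsilon> / C1))\<^sup>2 = \<epsilon>"
        using C1 \<open>\<epsilon> > 0\<close> by simp
      finally show ?thesis
        using C1 by simp
    qed
    then show ?thesis
      by blast
  qed
  ultimately show "form_converges M t X u"
    using Hp by (simp add: form_converges_def)
qed

lemma approx_exists:
  assumes "u \<in> Hp"
  obtains X where "approx X u"
proof -
  have "\<exists>g\<in>M. N (u - g) < 1 / real (Suc n)" for n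
    using dense[OF assms, of "1 / real (Suc n)"] by simp
  then obtain X where X: "\<And>n. X n \<in> M" "\<And>n. N (u - X n) < 1 / real (Suc n)"
    by metis
  have "(\<lambda>n. N (X n - u)) \<longlonglongrightarrow> 0"
  proof (rule Lim_null_comparison)
    show "\<forall>\<^sub>F n in sequentially. norm (N (X n - u)) \<le> inverse (real (Suc n))"
    proof (intro always_eventually allI)
      fix n
      have "X n \<in> Hp"
        using X M_Hp by blast
      then have "N (X n - u) \<ge> 0" "N (X n - u) = N (u - X n)"
        using assms by (auto intro!: N_nonneg Hp_closed N_minus_commute)
      then show "norm (N (X n - u)) \<le> inverse (real (Suc n))"
        using X(2)[of n] by (simp add: inverse_eq_divide)
    qed
  qed (rule LIMSEQ_inverse_real_of_nat)
  then show thesis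
    using X(1) assms by (intro that) (auto simp: approx_def)
qed

lemma form_closure_domain_eq: "form_closure_domain M t = Hp"
  unfolding form_closure_domain_def form_converges_iff
  using approx_exists approx_Hp(3) by blast

lemma t_diff:
  assumes "f \<in> M" "g \<in> M" "f' \<in> M" "g' \<in> M"
  shows "cmod (t f g - t f' g') \<le> C1 * N (f - f') * N g + C1 * N f' * N (g - g')"
proof -
  have "L (f - f') = L f - L f'"
    using L_add[of "f - f'" f'] M_closed(3)[of f f'] assms by (simp add: algebra_simps)
  then have "t f g - t f' g' = t (f - f') g + t f' (g - g')"
    by (simp add: cinner.diff_left cinner.diff_right)
  then have "cmod (t f g - t f' g') \<le> cmod (t (f - f') g) + cmod (t f' (g - g'))"
    using norm_triangle_ineq by metis
  also have "\<dots> \<le> C1 * N (f - f') * N g + C1 * N f' * N (g - g')"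
    by (intro add_mono L_le M_closed assms)
  finally show ?thesis .
qed

lemma approx_N_le: "approx X u \<Longrightarrow> N (X n) \<le> 2 * (N (X n - u) + N u)"
  using N_add_le[of "X n - u" u] approx_Hp[of X u] Hp_closed(3) by simp

lemma approx_bounded:
  assumes "approx X u"
  obtains B where "B > 0" "\<And>n. N (X n) \<le> B"
proof -
  obtain K where K: "\<And>n. norm (N (X n - u)) \<le> K"
    using convergent_imp_Bseq[OF convergentI[OF approx_lim[OF assms]]] unfolding Bseq_def by blast
  \<comment> \<open>The added 1 keeps the bound positive even for \<open>u = 0\<close>, as it is
    used as a divisor in \<open>t_convergent\<close>.\<close>
  have "N (X n) \<le> 2 * (K + N u) + 1" for n
    using approx_N_le[OF assms, of n] K[of n] by simp
  moreover have "2 * (K + N u) + 1 > 0"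
    using N_nonneg[OF approx_Hp(3)[OF assms]] order_trans[OF norm_ge_zero K[of 0]] by simp
  ultimately show thesis
    using that by blast
qed

lemma t_convergent:
  assumes "approx X u" "approx Y v"
  shows "convergent (\<lambda>n. t (X n) (Y n))"
proof -
  obtain A where A: "A > 0" "\<And>n. N (X n) \<le> A"
    using approx_bounded[OF assms(1)] by blast
  obtain B where B: "B > 0" "\<And>n. N (Y n) \<le> B"
    using approx_bounded[OF assms(2)] by blast
  note X = approx_Hp[OF assms(1)] and Y = approx_Hp[OF assms(2)]
  have "Cauchy (\<lambda>n. t (X n) (Y n))"
  proof (rule CauchyI)
    fix \<epsilon> :: real assume "\<epsilon> > 0"
    have "\<epsilon> / (2 * C1 * B) > 0"
      using \<open>\<epsilon> > 0\<close> C1 B by simp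
    then obtain k1 where k1: "\<And>m n. m \<ge> k1 \<Longrightarrow> n \<ge> k1 \<Longrightarrow> N (X m - X n) < \<epsilon> / (2 * C1 * B)"
      using N_diff_less[OF X(1) X(3) approx_lim[OF assms(1)]] by blast
    have "\<epsilon> / (2 * C1 * A) > 0"
      using \<open>\<epsilon> > 0\<close> C1 A by simp
    then obtain k2 where k2: "\<And>m n. m \<ge> k2 \<Longrightarrow> n \<ge> k2 \<Longrightarrow> N (Y m - Y n) < \<epsilon> / (2 * C1 * A)"
      using N_diff_less[OF Y(1) Y(3) approx_lim[OF assms(2)]] by blast
    have "cmod (t (X m) (Y m) - t (X n) (Y n)) < \<epsilon>" if "m \<ge> max k1 k2" "n \<ge> max k1 k2" for m n
    proof -
      have "cmod (t (X m) (Y m) - t (X n) (Y n))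
          \<le> C1 * N (X m - X n) * N (Y m) + C1 * N (X n) * N (Y m - Y n)"
        by (intro t_diff X Y)
      also have "\<dots> \<le> C1 * N (X m - X n) * B + C1 * A * N (Y m - Y n)"
        using C1 A B X Y by (intro add_mono mult_left_mono mult_right_mono mult_nonneg_nonneg
            N_nonneg Hp_closed) auto
      also have "C1 * N (X m - X n) * B < \<epsilon> / 2"
        using k1[of m n] that C1 B by (simp add: field_simps)
      also have "C1 * A * N (Y m - Y n) < \<epsilon> / 2"
        using k2[of m n] that C1 A by (simp add: field_simps)
      finally show ?thesis by simp
    qed
    then show "\<exists>k. \<forall>m\<ge>k. \<forall>n\<ge>k. norm (t (X m) (Y m) - t (X n) (Y n)) < \<epsilon>"
      by blast
  qed
  then show ?thesis
    by (simp add: Cauchy_convergent_iff)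
qed

lemma t_limits_agree:
  assumes "approx X u" "approx Y v" "approx X' u" "approx Y' v"
  shows "(\<lambda>n. t (X n) (Y n) - t (X' n) (Y' n)) \<longlonglongrightarrow> 0"
proof -
  obtain A where A: "A > 0" "\<And>n. N (X' n) \<le> A"
    using approx_bounded[OF assms(3)] by blast
  obtain B where B: "B > 0" "\<And>n. N (Y n) \<le> B"
    using approx_bounded[OF assms(2)] by blast
  note Hp = approx_Hp[OF assms(1)] approx_Hp[OF assms(2)] approx_Hp[OF assms(3)] approx_Hp[OF assms(4)]
  have diff: "N (Z n - Z' n) \<le> 2 * (N (Z n - w) + N (Z' n - w))"
    if "approx Z w" "approx Z' w" for Z Z' w n
    using N_diff_le[of "Z n - w" "Z' n - w"] approx_Hp[OF that(1)] approx_Hp[OF that(2)] Hp_closed(3)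
    by simp
  let ?b = "\<lambda>n. C1 * (2 * (N (X n - u) + N (X' n - u))) * B + C1 * A * (2 * (N (Y n - v) + N (Y' n - v)))"
  show ?thesis
  proof (rule Lim_null_comparison)
    show "\<forall>\<^sub>F n in sequentially. norm (t (X n) (Y n) - t (X' n) (Y' n)) \<le> ?b n"
    proof (intro always_eventually allI)
      fix n
      have "norm (t (X n) (Y n) - t (X' n) (Y' n))
          \<le> C1 * N (X n - X' n) * N (Y n) + C1 * N (X' n) * N (Y n - Y' n)"
        by (intro t_diff Hp)
      also have "\<dots> \<le> ?b n"
        using C1 A B Hp diff[OF assms(1,3)] diff[OF assms(2,4)]
        by (intro add_mono mult_mono mult_nonneg_nonneg N_nonneg Hp_closed add_nonneg_nonneg) auto
      finally show "norm (t (X n) (Y n) - t (X' n) (Y' n)) \<le> ?b n" .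
    qed
    have "?b \<longlonglongrightarrow> C1 * (2 * (0 + 0)) * B + C1 * A * (2 * (0 + 0))"
      using assms by (intro tendsto_intros approx_lim)
    then show "?b \<longlonglongrightarrow> 0"
      by simp
  qed
qed

text \<open>Resolves the definite description in \<open>form_closure\<close>: the limit exists, is
  the same for all approximating sequences, and such sequences are at hand.\<close>

lemma T_lim:
  assumes "approx X u" "approx Y v"
  shows "(\<lambda>n. t (X n) (Y n)) \<longlonglongrightarrow> T u v"
proof -
  obtain z where z: "(\<lambda>n. t (X n) (Y n)) \<longlonglongrightarrow> z"
    using t_convergent[OF assms] convergent_def by blast
  have all: "(\<lambda>n. t (X' n) (Y' n)) \<longlonglongrightarrow> z" if "approx X' u" "approx Y' v" for X' Y'
    using tendsto_diff[OF z t_limits_agree[OF assms that]] by simp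
  have "T u v = z"
    unfolding form_closure_def form_converges_iff
    by (rule the_equality) (use all assms z LIMSEQ_unique in blast)+
  then show ?thesis
    using z by simp
qed

lemma approx_add:
  assumes "approx X u" "approx Y v"
  shows "approx (\<lambda>n. X n + Y n) (u + v)"
proof -
  note X = approx_Hp[OF assms(1)] and Y = approx_Hp[OF assms(2)]
  have "(\<lambda>n. N (X n + Y n - (u + v))) \<longlonglongrightarrow> 0"
  proof (rule Lim_null_comparison)
    show "\<forall>\<^sub>F n in sequentially. norm (N (X n + Y n - (u + v))) \<le> 2 * (N (X n - u) + N (Y n - v))"
    proof (intro always_eventually allI)
      fix n
      have "N (X n + Y n - (u + v)) \<ge> 0"
        using X Y by (intro N_nonneg Hp_closed)
      moreover have "N ((X n - u) + (Y n - v)) \<le> 2 * (N (X n - u) + N (Y n - v))"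
        using X Y by (intro N_add_le Hp_closed)
      ultimately show "norm (N (X n + Y n - (u + v))) \<le> 2 * (N (X n - u) + N (Y n - v))"
        by (simp add: algebra_simps)
    qed
    have "(\<lambda>n. 2 * (N (X n - u) + N (Y n - v))) \<longlonglongrightarrow> 2 * (0 + 0)"
      by (intro tendsto_intros approx_lim assms)
    then show "(\<lambda>n. 2 * (N (X n - u) + N (Y n - v))) \<longlonglongrightarrow> 0"
      by simp
  qed
  then show ?thesis
    using X Y Hp_closed M_closed by (simp add: approx_def)
qed

lemma approx_scaleC:
  assumes "approx X u"
  shows "approx (\<lambda>n. c *\<^sub>C X n) (c *\<^sub>C u)"
proof -
  note X = approx_Hp[OF assms]
  have "N (c *\<^sub>C X n - c *\<^sub>C u) = cmod c * N (X n - u)" for n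
    using N_scaleC[of "X n - u" c] X Hp_closed by (simp add: scaleC.diff_right)
  moreover have "(\<lambda>n. cmod c * N (X n - u)) \<longlonglongrightarrow> cmod c * 0"
    by (intro tendsto_intros approx_lim assms)
  ultimately show ?thesis
    using X Hp_closed M_closed by (simp add: approx_def)
qed

lemma T_add_left:
  assumes "u \<in> Hp" "u' \<in> Hp" "v \<in> Hp"
  shows "T (u + u') v = T u v + T u' v"
proof -
  obtain X X' Y where *: "approx X u" "approx X' u'" "approx Y v"
    using assms approx_exists by metis
  have "(\<lambda>n. t (X n + X' n) (Y n)) \<longlonglongrightarrow> T u v + T u' v"
    using tendsto_add[OF T_lim[OF *(1,3)] T_lim[OF *(2,3)]] approx_Hp(2)[OF *(1)] approx_Hp(2)[OF *(2)]
    by (simp add: L_add cinner_add_left)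
  then show ?thesis
    using LIMSEQ_unique[OF T_lim[OF approx_add[OF *(1,2)] *(3)]] by blast
qed

lemma T_add_right:
  assumes "u \<in> Hp" "v \<in> Hp" "v' \<in> Hp"
  shows "T u (v + v') = T u v + T u v'"
proof -
  obtain X Y Y' where *: "approx X u" "approx Y v" "approx Y' v'"
    using assms approx_exists by metis
  have "(\<lambda>n. t (X n) (Y n + Y' n)) \<longlonglongrightarrow> T u v + T u v'"
    using tendsto_add[OF T_lim[OF *(1,2)] T_lim[OF *(1,3)]] by (simp add: cinner_add_right)
  then show ?thesis
    using LIMSEQ_unique[OF T_lim[OF *(1) approx_add[OF *(2,3)]]] by blast
qed

lemma T_scaleC:
  assumes "u \<in> Hp" "v \<in> Hp"
  shows "T (c *\<^sub>C u) v = c * T u v" "T u (c *\<^sub>C v) = cnj c * T u v"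
proof -
  obtain X Y where *: "approx X u" "approx Y v"
    using assms approx_exists by metis
  have "(\<lambda>n. t (c *\<^sub>C X n) (Y n)) \<longlonglongrightarrow> c * T u v"
    using tendsto_mult[OF tendsto_const T_lim[OF *]] approx_Hp(2)[OF *(1)]
    by (simp add: L_scaleC cinner_scaleC_left)
  then show "T (c *\<^sub>C u) v = c * T u v"
    using LIMSEQ_unique[OF T_lim[OF approx_scaleC[OF *(1)] *(2)]] by blast
  have "(\<lambda>n. t (X n) (c *\<^sub>C Y n)) \<longlonglongrightarrow> cnj c * T u v"
    using tendsto_mult[OF tendsto_const T_lim[OF *]] by (simp add: cinner_scaleC_right)
  then show "T u (c *\<^sub>C v) = cnj c * T u v"
    using LIMSEQ_unique[OF T_lim[OF *(1) approx_scaleC[OF *(2)]]] by blast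
qed

lemma T_bound:
  assumes "u \<in> Hp" "v \<in> Hp"
  shows "cmod (T u v) \<le> 4 * C1 * N u * N v"
proof -
  obtain X Y where *: "approx X u" "approx Y v"
    using assms approx_exists by metis
  let ?b = "\<lambda>n. C1 * (2 * (N (X n - u) + N u)) * (2 * (N (Y n - v) + N v))"
  have "cmod (t (X n) (Y n)) \<le> ?b n" for n
  proof -
    have "cmod (t (X n) (Y n)) \<le> C1 * N (X n) * N (Y n)"
      by (intro L_le approx_Hp(2)[OF *(1)] approx_Hp(2)[OF *(2)])
    also have "\<dots> \<le> ?b n"
      using C1 assms approx_Hp[OF *(1)] approx_Hp[OF *(2)] approx_N_le[OF *(1)] approx_N_le[OF *(2)]
      by (intro mult_mono mult_nonneg_nonneg add_nonneg_nonneg N_nonneg Hp_closed) auto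
    finally show ?thesis .
  qed
  moreover have "?b \<longlonglongrightarrow> C1 * (2 * (0 + N u)) * (2 * (0 + N v))"
    by (intro tendsto_intros approx_lim *)
  ultimately have "cmod (T u v) \<le> C1 * (2 * (0 + N u)) * (2 * (0 + N v))"
    using LIMSEQ_le[OF tendsto_norm[OF T_lim[OF *]]] by blast
  then show ?thesis
    by (simp add: mult_ac)
qed

text \<open>The bound passes to the limit through the splitting u = X n + (u - X n); the factor 2 is
  the price of \<open>N_add_sq_le\<close>.\<close>

lemma T_coercive:
  assumes "u \<in> Hp"
  shows "C2 * (N u)\<^sup>2 \<le> 2 * Re (T u u)"
proof -
  obtain X where X: "approx X u"
    using assms approx_exists by metis
  have "C2 * (N u)\<^sup>2 \<le> 2 * C2 * (N (X n - u))\<^sup>2 + 2 * Re (t (X n) (X n))" for n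
  proof -
    have "(N (X n + (u - X n)))\<^sup>2 \<le> 2 * (N (X n))\<^sup>2 + 2 * (N (u - X n))\<^sup>2"
      using approx_Hp[OF X] by (intro N_add_sq_le Hp_closed)
    then have "(N u)\<^sup>2 \<le> 2 * (N (X n))\<^sup>2 + 2 * (N (X n - u))\<^sup>2"
      using N_minus_commute[of "X n" u] approx_Hp[OF X] by simp
    then have "C2 * (N u)\<^sup>2 \<le> C2 * (2 * (N (X n))\<^sup>2 + 2 * (N (X n - u))\<^sup>2)"
      using C2 by (intro mult_left_mono) auto
    also have "\<dots> \<le> 2 * C2 * (N (X n - u))\<^sup>2 + 2 * Re (t (X n) (X n))"
      using L_ge[OF approx_Hp(2)[OF X], of n] by (simp add: algebra_simps)
    finally show ?thesis .
  qed
  moreover have "(\<lambda>n. 2 * C2 * (N (X n - u))\<^sup>2 + 2 * Re (t (X n) (X n)))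
      \<longlonglongrightarrow> 2 * C2 * 0\<^sup>2 + 2 * Re (T u u)"
    by (intro tendsto_intros approx_lim T_lim X)
  ultimately show ?thesis
    using LIMSEQ_le_const by fastforce
qed

section \<open>The real part \<open>H\<close>: energy estimate, compactness and diagonal
  form\<close>

abbreviation "h \<equiv> real_part_form T"
abbreviation "H \<equiv> friedrichs_Re M L"

lemma H_def: "H = {(u, w). u \<in> Hp \<and> (\<forall>v\<in>Hp. h u v = cinner w v)}"
  by (simp add: friedrichs_Re_def Let_def form_operator_def form_closure_domain_eq)

lemma h_commute: "h u v = cnj (h v u)"
  by (simp add: real_part_form_def add.commute)

lemma h_add_left:
  "u \<in> Hp \<Longrightarrow> u' \<in> Hp \<Longrightarrow> v \<in> Hp \<Longrightarrow> h (u + u') v = h u v + h u' v"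
  by (simp add: real_part_form_def T_add_left T_add_right add_divide_distrib)

lemma h_scaleC_left: "u \<in> Hp \<Longrightarrow> v \<in> Hp \<Longrightarrow> h (c *\<^sub>C u) v = c * h u v"
  by (simp add: real_part_form_def T_scaleC distrib_left)

lemma h_diff_left:
  assumes "u \<in> Hp" "u' \<in> Hp" "v \<in> Hp"
  shows "h (u - u') v = h u v - h u' v"
  using h_add_left[of "u - u'" u' v] assms Hp_closed(3) by simp

lemma h_bound:
  assumes "u \<in> Hp" "v \<in> Hp"
  shows "cmod (h u v) \<le> 4 * C1 * N u * N v"
proof -
  have "cmod (T u v + cnj (T v u)) \<le> cmod (T u v) + cmod (T v u)"
    using norm_triangle_ineq[of "T u v" "cnj (T v u)"] by simp
  then show ?thesis
    using T_bound[OF assms] T_bound[OF assms(2,1)]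
    by (simp add: real_part_form_def norm_divide mult_ac)
qed

text \<open>On the diagonal \<open>h\<close> and \<open>T\<close> have the same real part. This
  estimate yields positive eigenvalues, compactness of the inverse and closedness of
  \<open>H\<close>.\<close>

lemma H_energy:
  assumes "(u, w) \<in> H"
  shows "u \<in> Hp" "C2 * (N u)\<^sup>2 \<le> 2 * Re (cinner w u)"
proof -
  show u: "u \<in> Hp"
    using assms by (simp add: H_def)
  then have "h u u = cinner w u"
    using assms by (simp add: H_def)
  moreover have "Re (h u u) = Re (T u u)"
    by (simp add: real_part_form_def)
  ultimately show "C2 * (N u)\<^sup>2 \<le> 2 * Re (cinner w u)"
    using T_coercive[OF u] by simp
qed

lemma H_sum:
  assumes "finite A" "\<And>n. n \<in> A \<Longrightarrow> (x n, y n) \<in> H"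
  shows "(\<Sum>n\<in>A. c n *\<^sub>C x n, \<Sum>n\<in>A. c n *\<^sub>C y n) \<in> H"
  using assms
proof (induction A rule: finite_induct)
  case empty
  have "h 0 v = 0" if "v \<in> Hp" for v
    using h_scaleC_left[of v v 0] that by (simp add: scaleC.zero_left)
  then show ?case
    using Hp_closed(1) by (simp add: H_def cinner.zero_left)
next
  case (insert a A)
  then have "(x a, y a) \<in> H" "(\<Sum>n\<in>A. c n *\<^sub>C x n, \<Sum>n\<in>A. c n *\<^sub>C y n) \<in> H"
    by auto
  then show ?case
    using insert(1,2) Hp_closed
    by (simp add: H_def h_add_left h_scaleC_left cinner_add_left cinner_scaleC_left)
qed

text \<open>Compactness of H^(-1), phrased for pairs in the graph: bounded images under
  \<open>H\<close> force preimages bounded in \<open>Hp\<close>, where the compact embedding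
  applies.\<close>

lemma H_precompact:
  assumes "bounded (range Y)" "\<And>k. (X k, Y k) \<in> H"
  shows "\<exists>z r. strict_mono (r :: nat \<Rightarrow> nat) \<and> (\<lambda>k. X (r k)) \<longlonglongrightarrow> z"
proof -
  obtain B where B: "B > 0" "\<And>k. norm (Y k) \<le> B"
    using assms(1) by (auto simp: bounded_pos)
  \<comment> \<open>From C2 N^2 \<le> 2 B C0 N, the energy estimate after Cauchy-Schwarz and the
    embedding bound; dividing by N gives \<open>R\<close>.\<close>
  define R where "R = 2 * B * C0 / C2"
  have R: "R > 0"
    using B C0 C2 by (simp add: R_def)
  have le: "N (X k) \<le> R" for k
  proof (rule ccontr)
    assume "\<not> N (X k) \<le> R"
    then have pos: "N (X k) > R" "N (X k) > 0"
      using R by auto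
    have "C2 * (N (X k))\<^sup>2 \<le> 2 * Re (cinner (Y k) (X k))"
      by (rule H_energy[OF assms(2)])
    also have "\<dots> \<le> 2 * (norm (Y k) * norm (X k))"
      using complex_Re_le_cmod[of "cinner (Y k) (X k)"] cmod_cinner_le[of "Y k" "X k"] by linarith
    also have "norm (Y k) * norm (X k) \<le> B * (C0 * N (X k))"
      using B norm_le[OF H_energy(1)[OF assms(2)]] by (intro mult_mono) auto
    finally have "N (X k) * (C2 * N (X k)) \<le> N (X k) * (2 * B * C0)"
      by (simp add: power2_eq_square mult_ac)
    then have "C2 * N (X k) \<le> 2 * B * C0"
      using pos by simp
    then show False
      using pos C2 by (simp add: R_def field_simps)
  qed
  let ?K = "closure {f \<in> Hp. N f \<le> 1}"
  have "(1 / R) *\<^sub>R X k \<in> {f \<in> Hp. N f \<le> 1}" for k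
  proof -
    have X: "X k \<in> Hp"
      by (rule H_energy[OF assms(2)])
    have "N ((1 / R) *\<^sub>R X k) = N (X k) / R"
      using N_scaleC[OF X, of "of_real (1 / R)"] R unfolding scaleC_of_real norm_of_real by simp
    moreover have "(1 / R) *\<^sub>R X k \<in> Hp"
      using Hp_closed(4)[OF X, of "of_real (1 / R)"] unfolding scaleC_of_real .
    ultimately show ?thesis
      using le[of k] R by simp
  qed
  then have "\<forall>k. (1 / R) *\<^sub>R X k \<in> ?K"
    using closure_subset by blast
  moreover have "seq_compact ?K"
    using compact_ball compact_imp_seq_compact by blast
  ultimately have "\<exists>z\<in>?K. \<exists>r. strict_mono r \<and> ((\<lambda>k. (1 / R) *\<^sub>R X k) \<circ> r) \<longlonglongrightarrow> z"
    using seq_compact_def[of ?K] by simp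
  then obtain z r where r: "strict_mono r" and z: "((\<lambda>k. (1 / R) *\<^sub>R X k) \<circ> r) \<longlonglongrightarrow> z"
    by blast
  have "(\<lambda>k. R *\<^sub>R ((1 / R) *\<^sub>R X (r k))) \<longlonglongrightarrow> R *\<^sub>R z"
    using z by (intro tendsto_intros) (simp add: o_def)
  then have "(\<lambda>k. X (r k)) \<longlonglongrightarrow> R *\<^sub>R z"
    using R by simp
  then show ?thesis
    using r by blast
qed

lemma eigenvalue_pos:
  assumes "onb e" "(e n, of_real (lam n) *\<^sub>C e n) \<in> H"
  shows "lam n > 0"
proof -
  interpret onb e by fact
  have "e n \<noteq> 0"
    using norm_e[of n] by (metis norm_zero zero_neq_one)
  then have "N (e n) > 0"
    using ip_pos[OF H_energy(1)[OF assms(2)]] by (simp add: ip_norm_def)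
  then have "0 < C2 * (N (e n))\<^sup>2"
    using C2 by simp
  also have "\<dots> \<le> 2 * Re (cinner (of_real (lam n) *\<^sub>C e n) (e n))"
    by (rule H_energy[OF assms(2)])
  finally show ?thesis
    by (simp add: cinner_scaleC_left orthonormal)
qed

text \<open>Symmetry of \<open>h\<close> gives one inclusion. For the other, partial expansions lie
  in \<open>H\<close> and the energy estimate makes them Cauchy in \<open>Hp\<close>; completeness
  and boundedness of \<open>h\<close> carry the defining identity to the limit.\<close>

lemma H_eq_diag_op:
  assumes "onb e" and eig: "\<And>n. (e n, of_real (lam n) *\<^sub>C e n) \<in> H"
  shows "H = diag_op e lam"
proof (intro equalityI subrelI)
  fix u w assume uw: "(u, w) \<in> H"
  have "cinner w (e n) = of_real (lam n) * cinner u (e n)" for n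
  proof -
    have "cinner w (e n) = h u (e n)"
      using uw eig[of n] by (simp add: H_def)
    also have "\<dots> = cnj (h (e n) u)"
      by (rule h_commute)
    also have "\<dots> = cnj (cinner (of_real (lam n) *\<^sub>C e n) u)"
      using uw eig[of n] by (simp add: H_def)
    also have "\<dots> = of_real (lam n) * cinner u (e n)"
      using cinner_commute[of u "e n"] by (simp add: cinner_scaleC_left)
    finally show ?thesis .
  qed
  then show "(u, w) \<in> diag_op e lam"
    by (simp add: diag_op_def)
next
  interpret onb e by fact
  fix x y assume xy: "(x, y) \<in> diag_op e lam"
  define X where "X k = (\<Sum>n<k. cinner x (e n) *\<^sub>C e n)" for k
  define Y where "Y k = (\<Sum>n<k. cinner y (e n) *\<^sub>C e n)" for k
  have X: "X \<longlonglongrightarrow> x" and Y: "Y \<longlonglongrightarrow> y"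
    using expansion by (simp_all add: X_def[abs_def] Y_def[abs_def])
  have XY: "(X k, Y k) \<in> H" for k
  proof -
    have "Y k = (\<Sum>n<k. cinner x (e n) *\<^sub>C (of_real (lam n) *\<^sub>C e n))"
      by (simp add: Y_def diag_opD[OF xy] scaleC_scaleC mult.commute)
    then show ?thesis
      unfolding X_def using H_sum[OF _ eig, of "{..<k}" "\<lambda>n. cinner x (e n)"] by simp
  qed
  have XHp: "X k \<in> Hp" for k
    by (rule H_energy[OF XY])
  have energy: "C2 * (N (X m - X n))\<^sup>2 \<le> 2 * (norm (Y m - Y n) * norm (X m - X n))" for m n
  proof -
    have "(X m - X n, Y m - Y n) \<in> H"
      using XY[of m] XY[of n] by (simp add: H_def Hp_closed h_diff_left cinner.diff_left)
    from H_energy(2)[OF this] show ?thesis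
      using complex_Re_le_cmod[of "cinner (Y m - Y n) (X m - X n)"]
        cmod_cinner_le[of "Y m - Y n" "X m - X n"] by linarith
  qed
  have "\<exists>k. \<forall>m\<ge>k. \<forall>n\<ge>k. N (X m - X n) < \<epsilon>" if "\<epsilon> > 0" for \<epsilon>
  proof -
    \<comment> \<open>Chosen so that 2 \<delta>^2 = C2 \<epsilon>^2, which matches the two sides of
      \<open>energy\<close>.\<close>
    define \<delta> where "\<delta> = \<epsilon> * sqrt (C2 / 2)"
    have \<delta>: "\<delta> > 0" "2 * (\<delta> * \<delta>) = C2 * \<epsilon>\<^sup>2"
      using that C2 by (simp_all add: \<delta>_def power2_eq_square[symmetric] power_mult_distrib)
    obtain k1 where k1: "\<And>m n. m \<ge> k1 \<Longrightarrow> n \<ge> k1 \<Longrightarrow> norm (X m - X n) < \<delta>"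
      using CauchyD[OF LIMSEQ_imp_Cauchy[OF X] \<delta>(1)] by blast
    obtain k2 where k2: "\<And>m n. m \<ge> k2 \<Longrightarrow> n \<ge> k2 \<Longrightarrow> norm (Y m - Y n) < \<delta>"
      using CauchyD[OF LIMSEQ_imp_Cauchy[OF Y] \<delta>(1)] by blast
    have "N (X m - X n) < \<epsilon>" if "m \<ge> max k1 k2" "n \<ge> max k1 k2" for m n
    proof (rule power2_less_imp_less)
      have "norm (Y m - Y n) * norm (X m - X n) < \<delta> * \<delta>"
        using k1[of m n] k2[of m n] that by (intro mult_strict_mono') auto
      then have "C2 * (N (X m - X n))\<^sup>2 < C2 * \<epsilon>\<^sup>2"
        using energy[of m n] \<delta>(2) by linarith
      then show "(N (X m - X n))\<^sup>2 < \<epsilon>\<^sup>2"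
        using C2 by simp
    qed (use \<open>\<epsilon> > 0\<close> in simp)
    then show ?thesis
      by blast
  qed
  then obtain x' where x': "x' \<in> Hp" "(\<lambda>n. N (X n - x')) \<longlonglongrightarrow> 0"
    using Hp_complete[of X] XHp by blast
  then have "x' = x"
    using LIMSEQ_unique[OF X norm_lim[OF XHp]] by simp
  have "h x v = cinner y v" if v: "v \<in> Hp" for v
  proof -
    have "(\<lambda>k. h (X k) v - h x v) \<longlonglongrightarrow> 0"
    proof (rule Lim_null_comparison)
      show "\<forall>\<^sub>F k in sequentially. norm (h (X k) v - h x v) \<le> 4 * C1 * N (X k - x) * N v"
        using h_bound[of "X _ - x" v] XHp x'(1) v by (simp add: h_diff_left Hp_closed \<open>x' = x\<close>)
      have "(\<lambda>k. 4 * C1 * N (X k - x) * N v) \<longlonglongrightarrow> 4 * C1 * 0 * N v"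
        using x'(2) by (intro tendsto_intros) (simp add: \<open>x' = x\<close>)
      then show "(\<lambda>k. 4 * C1 * N (X k - x) * N v) \<longlonglongrightarrow> 0"
        by simp
    qed
    then have "(\<lambda>k. h (X k) v) \<longlonglongrightarrow> h x v"
      by (simp add: LIM_zero_iff)
    moreover have "h (X k) v = cinner (Y k) v" for k
      using XY[of k] v by (simp add: H_def)
    moreover have "(\<lambda>k. cinner (Y k) v) \<longlonglongrightarrow> cinner y v"
      by (intro cinner.tendsto Y tendsto_const)
    ultimately show ?thesis
      using LIMSEQ_unique by simp
  qed
  then show "(x, y) \<in> H"
    using x'(1) \<open>x' = x\<close> by (simp add: H_def)
qed

end

section \<open>Bounded diagonal operators\<close>

lemma op_graph_iff: "(x, y) \<in> op_graph f \<longleftrightarrow> y = f x"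
  by (auto simp: op_graph_def)

lemma op_graph_comp: "op_graph f O op_graph g = op_graph (\<lambda>x. g (f x))"
  by (auto simp: op_graph_def)

lemma clinear_op_comp: "clinear_op f \<Longrightarrow> clinear_op g \<Longrightarrow> clinear_op (\<lambda>x. f (g x))"
  unfolding clinear_op_def using bounded_linear_compose by metis

lemma clinear_opI:
  assumes "\<And>x y. f (x + y) = f x + f y" "\<And>c x. f (c *\<^sub>C x) = c *\<^sub>C f x" "\<And>x. norm (f x) \<le> C * norm x"
  shows "clinear_op f"
  unfolding clinear_op_def
proof (intro conjI allI)
  show "bounded_linear f"
    using assms by (intro bounded_linear_intro[of f C]) (simp_all add: scaleR_scaleC mult.commute)
qed (rule assms(2))

lemma clinear_op_sum:
  assumes "clinear_op f"
  shows "f (\<Sum>j\<in>A. c j *\<^sub>C x j) = (\<Sum>j\<in>A. c j *\<^sub>C f (x j))"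
proof -
  interpret bounded_linear f
    using assms by (simp add: clinear_op_def)
  show ?thesis
    using assms by (simp add: sum clinear_op_def)
qed

context onb
begin

text \<open>A function version of \<open>diag_op e d\<close>; the choice has a value at every
  \<open>x\<close> when \<open>d\<close> is bounded.\<close>

definition diag_fun :: "(nat \<Rightarrow> real) \<Rightarrow> 'a \<Rightarrow> 'a" where
  "diag_fun d x = (SOME y. (x, y) \<in> diag_op e d)"

lemma diag_fun_coeff:
  assumes "\<And>n. \<bar>d n\<bar> \<le> C"
  shows "cinner (diag_fun d x) (e n) = of_real (d n) * cinner x (e n)"
proof -
  have "C \<ge> 0"
    using assms[of 0] by linarith
  moreover have "cmod (of_real (d n) * cinner x (e n)) \<le> C * cmod (cinner x (e n))" for n
    using assms[of n] by (simp add: norm_mult mult_right_mono)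
  ultimately obtain y where "\<And>n. cinner y (e n) = of_real (d n) * cinner x (e n)"
    by (rule coefficients_dominated) blast
  then have "\<exists>y. (x, y) \<in> diag_op e d"
    by (auto simp: diag_op_def)
  then have "(x, diag_fun d x) \<in> diag_op e d"
    unfolding diag_fun_def by (rule someI_ex)
  then show ?thesis
    by (rule diag_opD)
qed

lemma clinear_op_diag_fun:
  assumes "\<And>n. \<bar>d n\<bar> \<le> C"
  shows "clinear_op (diag_fun d)"
proof (rule clinear_opI)
  note coeff = diag_fun_coeff[OF assms]
  show "diag_fun d (x + y) = diag_fun d x + diag_fun d y" for x y
    by (rule eqI) (simp add: coeff cinner_add_left distrib_left)
  show "diag_fun d (c *\<^sub>C x) = c *\<^sub>C diag_fun d x" for c x
    by (rule eqI) (simp add: coeff cinner_scaleC_left)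
  have "C \<ge> 0"
    using assms[of 0] by linarith
  then show "norm (diag_fun d x) \<le> C * norm x" for x
    using assms by (intro norm_le_by_coeffs) (simp_all add: coeff norm_mult mult_right_mono)
qed

end

section \<open>Relatively small perturbations\<close>

text \<open>The Hilbert-Schmidt bound is required on finite rectangles only, which avoids double
  series in the estimates below.\<close>

locale relatively_small = onb e for e :: "nat \<Rightarrow> 'a :: chilbert_space" +
  fixes lam :: "nat \<Rightarrow> real" and G :: "'a \<Rightarrow> 'a" and \<beta> :: real
  assumes lam_pos: "lam n > 0" and lam_mono: "incseq lam"
    and G_clinear: "clinear_op G" and G_symmetric: "cinner (G x) y = cinner x (G y)"
    and \<beta>: "0 \<le> \<beta>" "\<beta> < 1"
    and HS: "(\<Sum>n<m. \<Sum>k<l. (cmod (cinner (G (e k)) (e n)))\<^sup>2 * lam n / lam k) \<le> \<beta>\<^sup>2"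
begin

sublocale G: bounded_linear G
  using G_clinear by (simp add: clinear_op_def)

lemma G_scaleC: "G (c *\<^sub>C x) = c *\<^sub>C G x"
  using G_clinear by (simp add: clinear_op_def)

abbreviation "r \<equiv> \<lambda>n. sqrt (lam n)"

lemma r_pos: "r n > 0"
  using lam_pos by simp

lemma nonzero: "r n \<noteq> 0" "lam n \<noteq> 0"
  using lam_pos[of n] by auto

text \<open>\<open>J\<close> is H^(-1/2) and \<open>K\<close> is H^(-1); both are bounded because
  the lowest eigenvalue \<open>lam 0\<close> is positive.\<close>

definition J :: "'a \<Rightarrow> 'a" where "J = diag_fun (\<lambda>n. 1 / r n)"
definition K :: "'a \<Rightarrow> 'a" where "K = diag_fun (\<lambda>n. 1 / lam n)"

lemma inverse_bounds: "\<bar>1 / r n\<bar> \<le> 1 / r 0" "\<bar>1 / lam n\<bar> \<le> 1 / lam 0"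
  using lam_pos[of 0] lam_pos[of n] incseqD[OF lam_mono, of 0 n] by (auto intro!: divide_left_mono)

lemma J_coeff: "cinner (J x) (e n) = of_real (1 / r n) * cinner x (e n)"
  unfolding J_def by (rule diag_fun_coeff[OF inverse_bounds(1)])

lemma K_coeff: "cinner (K x) (e n) = of_real (1 / lam n) * cinner x (e n)"
  unfolding K_def by (rule diag_fun_coeff[OF inverse_bounds(2)])

lemma J_clinear: "clinear_op J"
  unfolding J_def by (rule clinear_op_diag_fun[OF inverse_bounds(1)])

lemma K_clinear: "clinear_op K"
  unfolding K_def by (rule clinear_op_diag_fun[OF inverse_bounds(2)])

sublocale J: bounded_linear J
  using J_clinear by (simp add: clinear_op_def)

lemma J_scaleC: "J (c *\<^sub>C x) = c *\<^sub>C J x"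
  using J_clinear by (simp add: clinear_op_def)

lemma JJ: "J (J x) = K x"
proof (rule eqI)
  fix n
  have "r n * r n = lam n"
    using lam_pos[of n] by simp
  then show "cinner (J (J x)) (e n) = cinner (K x) (e n)"
    by (simp add: J_coeff K_coeff flip: of_real_mult)
qed

lemma J_inj: "J x = J y \<Longrightarrow> x = y"
proof (rule eqI)
  fix n assume "J x = J y"
  then have "of_real (1 / r n) * cinner x (e n) = of_real (1 / r n) * cinner y (e n)"
    using J_coeff by metis
  then show "cinner x (e n) = cinner y (e n)"
    using r_pos[of n] by simp
qed

lemma K_inj: "K x = K y \<Longrightarrow> x = y"
  unfolding JJ[symmetric] using J_inj by blast

lemma diag_op_r_iff: "(x, y) \<in> diag_op e r \<longleftrightarrow> x = J y"
proof
  assume "(x, y) \<in> diag_op e r"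
  then show "x = J y"
    by (intro eqI) (simp add: J_coeff diag_opD nonzero)
next
  assume "x = J y"
  then show "(x, y) \<in> diag_op e r"
    by (simp add: diag_op_def J_coeff nonzero)
qed

lemma K_diag_op: "(K y, y) \<in> diag_op e lam"
  by (simp add: diag_op_def K_coeff nonzero)

text \<open>The vector \<open>z\<close> is the formal H^(1/2) G H^(-1/2) x. Its coefficients
  \<open>c n\<close> make sense before \<open>G (J x)\<close> is known to lie in the domain of
  H^(1/2), and the Hilbert-Schmidt bound makes them square summable.\<close>

lemma G_J_factors: "\<exists>z. J z = G (J x) \<and> norm z \<le> \<beta> * norm x"
proof -
  define c where "c n = of_real (r n) * cinner (G (J x)) (e n)" for n
  define b where "b n k = of_real (r n / r k) * cinner (G (e k)) (e n)" for n k
  have lim: "(\<lambda>l. \<Sum>k<l. cinner x (e k) * b n k) \<longlonglongrightarrow> c n" for n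
  proof -
    have "(\<lambda>l. of_real (r n) * cinner (G (\<Sum>k<l. cinner (J x) (e k) *\<^sub>C e k)) (e n)) \<longlonglongrightarrow> c n"
      unfolding c_def by (intro tendsto_intros cinner.tendsto G.tendsto expansion)
    moreover have "of_real (r n) * cinner (G (\<Sum>k<l. cinner (J x) (e k) *\<^sub>C e k)) (e n)
        = (\<Sum>k<l. cinner x (e k) * b n k)" for l
      by (simp add: clinear_op_sum[OF G_clinear] cinner.sum_left cinner_scaleC_left J_coeff b_def
          sum_distrib_left mult_ac)
    ultimately show ?thesis
      by simp
  qed
  have b_sq: "(cmod (b n k))\<^sup>2 = (cmod (cinner (G (e k)) (e n)))\<^sup>2 * lam n / lam k" for n k
    using lam_pos[of n] lam_pos[of k] unfolding b_def norm_mult norm_of_real power_mult_distrib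
    by (simp add: power_divide)
  have "(\<Sum>n<m. (cmod (c n))\<^sup>2) \<le> (\<beta> * norm x)\<^sup>2" for m
  \<comment> \<open>For fixed \<open>m\<close> the bound is proved with \<open>x\<close> truncated
    to \<open>l\<close> coefficients, by Cauchy-Schwarz in \<open>k\<close>; then \<open>l\<close>
    tends to infinity.\<close>
  proof (rule LIMSEQ_le_const2)
    show "(\<lambda>l. \<Sum>n<m. (cmod (\<Sum>k<l. cinner x (e k) * b n k))\<^sup>2) \<longlonglongrightarrow> (\<Sum>n<m. (cmod (c n))\<^sup>2)"
      by (intro tendsto_intros lim)
    have "(\<Sum>n<m. (cmod (\<Sum>k<l. cinner x (e k) * b n k))\<^sup>2) \<le> (\<beta> * norm x)\<^sup>2" for l
    proof -
      have "(cmod (\<Sum>k<l. cinner x (e k) * b n k))\<^sup>2 \<le> (norm x)\<^sup>2 * (\<Sum>k<l. (cmod (b n k))\<^sup>2)" for n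
      proof -
        have "cmod (\<Sum>k<l. cinner x (e k) * b n k) \<le> (\<Sum>k<l. cmod (cinner x (e k)) * cmod (b n k))"
          unfolding norm_mult[symmetric] by (rule norm_sum)
        then have "(cmod (\<Sum>k<l. cinner x (e k) * b n k))\<^sup>2
            \<le> (\<Sum>k<l. cmod (cinner x (e k)) * cmod (b n k))\<^sup>2"
          by (rule power_mono) simp
        also have "\<dots> \<le> (\<Sum>k<l. (cmod (cinner x (e k)))\<^sup>2) * (\<Sum>k<l. (cmod (b n k))\<^sup>2)"
          by (rule Cauchy_Schwarz_ineq_sum)
        also have "\<dots> \<le> (norm x)\<^sup>2 * (\<Sum>k<l. (cmod (b n k))\<^sup>2)"
          by (intro mult_right_mono bessel sum_nonneg) simp_all
        finally show ?thesis .
      qed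
      then have "(\<Sum>n<m. (cmod (\<Sum>k<l. cinner x (e k) * b n k))\<^sup>2)
          \<le> (\<Sum>n<m. (norm x)\<^sup>2 * (\<Sum>k<l. (cmod (b n k))\<^sup>2))"
        by (rule sum_mono)
      also have "\<dots> \<le> (norm x)\<^sup>2 * \<beta>\<^sup>2"
        unfolding sum_distrib_left[symmetric] b_sq by (intro mult_left_mono HS) simp
      finally show ?thesis
        by (simp add: power_mult_distrib mult.commute)
    qed
    then show "\<exists>l0. \<forall>l\<ge>l0. (\<Sum>n<m. (cmod (\<Sum>k<l. cinner x (e k) * b n k))\<^sup>2) \<le> (\<beta> * norm x)\<^sup>2"
      by (intro exI allI impI)
  qed
  from riesz_fischer[OF this] obtain z where z: "\<And>n. cinner z (e n) = c n" "(norm z)\<^sup>2 \<le> (\<beta> * norm x)\<^sup>2"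
    by metis
  have "J z = G (J x)"
    by (intro eqI) (simp add: J_coeff z(1) c_def nonzero)
  moreover have "norm z \<le> \<beta> * norm x"
    by (rule power2_le_imp_le[OF z(2)]) (simp add: \<beta>(1))
  ultimately show ?thesis
    by (intro exI conjI)
qed

text \<open>An everywhere defined version of \<open>H\<^bsup>1/2\<^esup> G H\<^bsup>-1/2\<^esup>\<close>.\<close>

definition B :: "'a \<Rightarrow> 'a" where
  "B x = (SOME z. J z = G (J x) \<and> norm z \<le> \<beta> * norm x)"

lemma J_B: "J (B x) = G (J x)" and norm_B: "norm (B x) \<le> \<beta> * norm x"
  using someI_ex[OF G_J_factors, of x] unfolding B_def by auto

text \<open>The pointwise choice is linear because \<open>J\<close> is injective and
  \<open>G J\<close> is linear.\<close>

lemma B_add: "B (x + y) = B x + B y"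
  by (rule J_inj) (simp add: J.add J_B G.add)

lemma B_scaleC: "B (c *\<^sub>C x) = c *\<^sub>C B x"
  by (rule J_inj) (simp add: J_scaleC J_B G_scaleC)

section \<open>The operator I + iB and its bounded inverse\<close>

definition P :: "'a \<Rightarrow> 'a" where "P x = x + \<i> *\<^sub>C B x"

lemma norm_iB: "norm (\<i> *\<^sub>C B x) \<le> \<beta> * norm x"
  using norm_B by (simp add: norm_scaleC)

text \<open>The origin of the final constants: 1 + \<beta> bounds \<open>P\<close>, and the lower
  bound gives 1/(1 - \<beta>) for its inverse \<open>Q\<close>.\<close>

lemma P_norm: "(1 - \<beta>) * norm x \<le> norm (P x)" "norm (P x) \<le> (1 + \<beta>) * norm x"
proof -
  have "norm x \<le> norm (P x) + norm (\<i> *\<^sub>C B x)"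
    using norm_triangle_ineq4[of "P x" "\<i> *\<^sub>C B x"] by (simp add: P_def)
  then show "(1 - \<beta>) * norm x \<le> norm (P x)"
    using norm_iB[of x] by (simp add: algebra_simps)
  have "norm (P x) \<le> norm x + norm (\<i> *\<^sub>C B x)"
    unfolding P_def by (rule norm_triangle_ineq)
  then show "norm (P x) \<le> (1 + \<beta>) * norm x"
    using norm_iB[of x] by (simp add: algebra_simps)
qed

lemma P_clinear: "clinear_op P"
  by (rule clinear_opI[OF _ _ P_norm(2)])
    (simp_all add: P_def B_add B_scaleC scaleC_add_right scaleC_scaleC mult.commute add_ac)

sublocale P: bounded_linear P
  using P_clinear by (simp add: clinear_op_def)

lemma P_inj: "P x = P y \<Longrightarrow> x = y"
  using P_norm(1)[of "x - y"] \<beta>(2) by (simp add: P.diff mult_le_0_iff)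

text \<open>A preimage of \<open>w\<close> is a fixed point of x \<mapsto> w - iBx, a contraction
  since \<beta> < 1.\<close>

lemma P_surj: "\<exists>x. P x = w"
proof -
  have "\<exists>!x. w - \<i> *\<^sub>C B x = x"
  proof (rule banach_fix_type[OF \<beta>], intro allI)
    fix x y
    have "\<i> *\<^sub>C B (x - y) = \<i> *\<^sub>C B x - \<i> *\<^sub>C B y"
      using B_add[of "x - y" y] by (simp add: scaleC.diff_right[symmetric])
    then have "norm (\<i> *\<^sub>C B x - \<i> *\<^sub>C B y) \<le> \<beta> * norm (x - y)"
      using norm_iB[of "x - y"] by simp
    then show "dist (w - \<i> *\<^sub>C B x) (w - \<i> *\<^sub>C B y) \<le> \<beta> * dist x y"
      by (simp add: dist_norm norm_minus_commute)
  qed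
  then obtain x where "w - \<i> *\<^sub>C B x = x"
    by blast
  then have "w = P x"
    unfolding P_def diff_eq_eq .
  then show ?thesis
    by blast
qed

definition Q :: "'a \<Rightarrow> 'a" where "Q w = (SOME x. P x = w)"

lemma P_Q: "P (Q w) = w"
  unfolding Q_def by (rule someI_ex[OF P_surj])

lemma Q_P: "Q (P x) = x"
  using P_inj P_Q by blast

lemma norm_Q: "norm (Q w) \<le> 1 / (1 - \<beta>) * norm w"
  using P_norm(1)[of "Q w"] \<beta>(2) by (simp add: P_Q field_simps)

lemma Q_clinear: "clinear_op Q"
proof (rule clinear_opI[OF _ _ norm_Q])
  show "Q (x + y) = Q x + Q y" for x y
    by (rule P_inj) (simp add: P_Q P.add)
  show "Q (c *\<^sub>C x) = c *\<^sub>C Q x" for c x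
    by (rule P_inj) (use P_clinear in \<open>simp add: P_Q clinear_op_def\<close>)
qed

text \<open>Symmetry makes (Gd, d) real, so the real part of ((I + iG)d, d) is the squared norm of
  d.\<close>

lemma one_plus_iG_inj:
  assumes "p + \<i> *\<^sub>C G p = q + \<i> *\<^sub>C G q"
  shows "p = q"
proof -
  let ?d = "p - q"
  have "?d + \<i> *\<^sub>C G ?d = 0"
    using assms by (simp add: G.diff scaleC.diff_right algebra_simps)
  then have "cinner ?d ?d + \<i> * cinner (G ?d) ?d = 0"
    using cinner_add_left[of ?d "\<i> *\<^sub>C G ?d" ?d] by (simp add: cinner.zero_left cinner_scaleC_left)
  moreover have "Im (cinner (G ?d) ?d) = 0"
    using arg_cong[OF cinner_commute[of "G ?d" ?d], of Im] G_symmetric[of ?d ?d] by simp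
  ultimately have "Re (cinner ?d ?d) = 0"
    by (simp add: complex_eq_iff)
  then show ?thesis
    by (simp add: cinner_self)
qed

text \<open>Since \<open>G J = J B\<close>, the operator \<open>I + iG\<close> is conjugated by \<open>J = H\<^bsup>-1/2\<^esup>\<close> into \<open>P = I + iB\<close>.\<close>

lemma factorised_inverse:
  "(diag_op e r O op_graph (\<lambda>x. x + \<i> *\<^sub>C G x) O diag_op e r)\<inverse> = op_graph (\<lambda>w. K (Q w))"
proof -
  have JP: "J (Q w) + \<i> *\<^sub>C G (J (Q w)) = J w" for w
  proof -
    have "J (Q w) + \<i> *\<^sub>C G (J (Q w)) = J (P (Q w))"
      by (simp add: P_def J.add J_scaleC J_B)
    then show ?thesis
      by (simp add: P_Q)
  qed
  \<comment> \<open>\<open>J (Q w)\<close> is one solution and injectivity excludes others, so I +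
    iG itself never has to be inverted.\<close>
  then have iff: "p + \<i> *\<^sub>C G p = J w \<longleftrightarrow> p = J (Q w)" for p w
    using one_plus_iG_inj[of p "J (Q w)"] by auto
  have "(u, w) \<in> diag_op e r O op_graph (\<lambda>x. x + \<i> *\<^sub>C G x) O diag_op e r \<longleftrightarrow> u = K (Q w)" for u w
  proof -
    have "(u, w) \<in> diag_op e r O op_graph (\<lambda>x. x + \<i> *\<^sub>C G x) O diag_op e r
        \<longleftrightarrow> (\<exists>p. u = J p \<and> p + \<i> *\<^sub>C G p = J w)"
      by (auto simp: relcomp_unfold op_graph_iff diag_op_r_iff)
    then show ?thesis
      by (simp add: iff JJ)
  qed
  then show ?thesis
    by (intro set_eqI) (simp only: split_paired_all converse_iff op_graph_iff)
qed

end

section \<open>Comparison of the singular numbers\<close>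

text \<open>\<open>T\<close> stands for A'A with A = KQ, so \<tau> n is a squared singular number.
  Each bound tests one vector from an (n+1)-dimensional space that satisfies \<open>n\<close>
  orthogonality conditions.\<close>

lemma min_max_bounds:
  assumes "relatively_small e lam G \<beta>" "positive_compact T" "onb f"
    and A: "\<And>x. Re (cinner (T x) x) = (norm (relatively_small.K e lam (relatively_small.Q e lam G \<beta> x)))\<^sup>2"
    and \<tau>: "\<And>n. \<tau> n > 0" "decseq \<tau>" "\<And>n. T (f n) = of_real (\<tau> n) *\<^sub>C f n"
    "\<And>n x. (\<And>i. i < n \<Longrightarrow> cinner x (f i) = 0) \<Longrightarrow> Re (cinner (T x) x) \<le> \<tau> n * (norm x)\<^sup>2"
  shows "1 / (1 + \<beta>) * inverse (lam n) \<le> sqrt (\<tau> n)"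
    and "sqrt (\<tau> n) \<le> 1 / (1 - \<beta>) * inverse (lam n)"
proof -
  interpret relatively_small e lam G \<beta> by fact
  interpret T: positive_compact T by fact
  interpret f: onb f by fact
  note A = A[folded K_def]
  show "1 / (1 + \<beta>) * inverse (lam n) \<le> sqrt (\<tau> n)"
  proof -
    \<comment> \<open>The test vector for \<open>T\<close> is \<open>P z\<close>, since A undoes
      \<open>P\<close> and leaves \<open>K z\<close>, with \<open>z\<close> in the span of the first
      n+1 eigenvectors of \<open>H\<close>.\<close>
    obtain c z where z: "z = (\<Sum>j\<le>n. c j *\<^sub>C e j)" "z \<noteq> 0"
      and orth: "\<And>i. i < n \<Longrightarrow> (\<Sum>j\<le>n. c j * cinner (P (e j)) (f i)) = 0"
      using orthogonal_vector_in_span[of n P f] by metis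
    have "cinner (P z) (f i) = 0" if "i < n" for i
      using orth[OF that]
      by (simp add: z(1) clinear_op_sum[OF P_clinear] cinner.sum_left cinner_scaleC_left)
    then have "Re (cinner (T (P z)) (P z)) \<le> \<tau> n * (norm (P z))\<^sup>2"
      by (rule \<tau>(4))
    then have 1: "(norm (K z))\<^sup>2 \<le> \<tau> n * (norm (P z))\<^sup>2"
      by (simp add: A Q_P)
    \<comment> \<open>Coefficients of \<open>z\<close> beyond index \<open>n\<close> vanish, and
      \<open>K\<close> divides the others by at most \<open>lam n\<close>.\<close>
    have "norm z \<le> lam n * norm (K z)"
    proof (rule norm_le_by_coeffs)
      fix j
      show "cmod (cinner z (e j)) \<le> lam n * cmod (cinner (K z) (e j))"
      proof (cases "j \<le> n")
        case True
        then have "lam j \<le> lam n"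
          using lam_mono incseqD by blast
        then have "cmod (cinner z (e j)) * lam j \<le> lam n * cmod (cinner z (e j))"
          by (simp add: mult.commute mult_right_mono)
        then show ?thesis
          using lam_pos[of j] by (simp add: K_coeff norm_mult norm_divide field_simps)
      qed (use lam_pos[of n] in \<open>simp add: z(1) cinner_sum_e\<close>)
    qed (use lam_pos[of n] in simp)
    also have "\<dots> \<le> lam n * (sqrt (\<tau> n) * norm (P z))"
      using real_le_rsqrt[OF 1] lam_pos[of n] by (intro mult_left_mono) (simp_all add: real_sqrt_mult)
    also have "\<dots> \<le> lam n * (sqrt (\<tau> n) * ((1 + \<beta>) * norm z))"
      using lam_pos[of n] \<tau>(1)[of n] by (intro mult_left_mono P_norm(2)) simp_all
    finally have "1 * norm z \<le> (lam n * sqrt (\<tau> n) * (1 + \<beta>)) * norm z"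
      by (simp add: mult_ac)
    then have "1 \<le> lam n * sqrt (\<tau> n) * (1 + \<beta>)"
      using z(2) by (simp only: mult_le_cancel_right) simp
    moreover have "(1 + \<beta>) * lam n > 0"
      using lam_pos[of n] \<beta>(1) by simp
    ultimately have "1 / ((1 + \<beta>) * lam n) \<le> sqrt (\<tau> n)"
      by (simp only: pos_divide_le_eq mult_ac)
    then show ?thesis
      by (simp add: divide_inverse)
  qed
  show "sqrt (\<tau> n) \<le> 1 / (1 - \<beta>) * inverse (lam n)"
  proof -
    \<comment> \<open>Roles exchanged: \<open>x\<close> lies in the span of eigenvectors of
      \<open>T\<close>, and \<open>Q x\<close> avoids the first \<open>n\<close> eigenvectors of
      \<open>H\<close>.\<close>
    obtain c x where x: "x = (\<Sum>j\<le>n. c j *\<^sub>C f j)" "x \<noteq> 0"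
      and orth: "\<And>i. i < n \<Longrightarrow> (\<Sum>j\<le>n. c j * cinner (Q (f j)) (e i)) = 0"
      using f.orthogonal_vector_in_span[of n Q e] by metis
    have perp: "cinner (Q x) (e i) = 0" if "i < n" for i
      using orth[OF that]
      by (simp add: x(1) clinear_op_sum[OF Q_clinear] cinner.sum_left cinner_scaleC_left)
    \<comment> \<open>Since \<tau> decreases, the form of \<open>T\<close> is at least \<tau> n
      times the squared norm on this span.\<close>
    have "\<tau> n * (norm x)\<^sup>2 = (\<Sum>j\<le>n. \<tau> n * (cmod (c j))\<^sup>2)"
      by (simp add: x(1) f.norm_sum_e sum_distrib_left)
    also have "\<dots> \<le> (\<Sum>j\<le>n. \<tau> j * (cmod (c j))\<^sup>2)"
      using \<tau>(2) by (intro sum_mono mult_right_mono) (auto dest: decseqD)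
    also have "\<dots> = Re (cinner (T x) x)"
    proof -
      have "cinner (f j) x = cnj (c j)" if "j \<le> n" for j
        using that f.cinner_sum_e[of "{..n}" c j] cinner_commute[of "f j" x] by (simp add: x(1))
      then have "cinner (T x) x = (\<Sum>j\<le>n. c j * (of_real (\<tau> j) * cnj (c j)))"
        by (subst (1) x(1))
          (simp add: clinear_op_sum[OF T.clinear] cinner.sum_left cinner_scaleC_left \<tau>(3) mult.assoc)
      also have "\<dots> = of_real (\<Sum>j\<le>n. \<tau> j * (cmod (c j))\<^sup>2)"
        unfolding of_real_sum of_real_mult complex_norm_square by (simp add: mult_ac)
      finally show ?thesis
        by simp
    qed
    also have "\<dots> = (norm (K (Q x)))\<^sup>2"
      by (rule A)
    finally have "sqrt (\<tau> n) * norm x \<le> norm (K (Q x))"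
      using \<tau>(1)[of n] by (intro power2_le_imp_le[OF _ norm_ge_zero]) (simp_all add: power_mult_distrib)
    \<comment> \<open>The coefficients of \<open>Q x\<close> below \<open>n\<close> vanish, and
      \<open>K\<close> multiplies the remaining ones by at most 1 / lam n.\<close>
    also have "\<dots> \<le> 1 / lam n * norm (Q x)"
    proof (rule norm_le_by_coeffs)
      fix j
      show "cmod (cinner (K (Q x)) (e j)) \<le> 1 / lam n * cmod (cinner (Q x) (e j))"
      proof (cases "j < n")
        case False
        then have "lam n \<le> lam j"
          using lam_mono incseqD[of lam n j] by simp
        then show ?thesis
          using lam_pos[of n] lam_pos[of j]
          by (simp add: K_coeff norm_mult norm_divide divide_left_mono)
      qed (simp add: perp K_coeff)
    qed (use lam_pos[of n] in simp)
    also have "\<dots> \<le> 1 / lam n * (1 / (1 - \<beta>) * norm x)"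
      using lam_pos[of n] by (intro mult_left_mono norm_Q) simp
    finally have "sqrt (\<tau> n) * norm x \<le> (1 / (1 - \<beta>) * inverse (lam n)) * norm x"
      by (simp add: divide_inverse mult_ac)
    then show ?thesis
      using x(2) by (simp only: mult_le_cancel_right) simp
  qed
qed

text \<open>The explicit formula for the adjoint makes A'A an everywhere defined positive compact
  operator, so its eigenbasis diagonalises the modulus of W^-1.\<close>

lemma singular_number_bounds:
  assumes small: "relatively_small e lam G \<beta>" "relatively_small e lam (\<lambda>x. - G x) \<beta>"
    and compact: "compact_op (relatively_small.K e lam)"
    and adj: "adjoint_op (W\<inverse>) = op_graph (\<lambda>w. relatively_small.K e lam (relatively_small.Q e lam (\<lambda>x. - G x) \<beta> w))"
    and W: "W\<inverse> = op_graph (\<lambda>w. relatively_small.K e lam (relatively_small.Q e lam G \<beta> w))"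
  shows "1 / (1 + \<beta>) * inverse (lam n) \<le> singular_number (W\<inverse>) n"
    and "singular_number (W\<inverse>) n \<le> 1 / (1 - \<beta>) * inverse (lam n)"
proof -
  interpret S: relatively_small e lam G \<beta> by fact
  interpret S': relatively_small e lam "\<lambda>x. - G x" \<beta> by fact
  define A where "A w = S.K (S.Q w)" for w
  define A' where "A' w = S.K (S'.Q w)" for w
  define T where "T x = A' (A x)" for x
  have A_clinear: "clinear_op A" and A'_clinear: "clinear_op A'"
    using clinear_op_comp[OF S.K_clinear S.Q_clinear] clinear_op_comp[OF S.K_clinear S'.Q_clinear]
    by (simp_all add: A_def[abs_def] A'_def[abs_def])
  have AA': "cinner (A x) y = cinner x (A' y)" for x y
  proof -
    have "(y, A' y) \<in> adjoint_op (W\<inverse>)"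
      by (simp add: adj A'_def op_graph_def)
    moreover have "(x, A x) \<in> W\<inverse>"
      unfolding W by (simp add: A_def op_graph_def)
    ultimately show ?thesis
      by (rule adjoint_opD)
  qed
  have A'A: "cinner (A' x) y = cinner x (A y)" for x y
    unfolding cinner_commute[of "A' x" y] cinner_commute[of x "A y"] AA' ..
  have Re_T: "Re (cinner (T x) x) = (norm (A x))\<^sup>2" for x
    by (simp add: T_def A'A cinner_self flip: of_real_power)
  have A_inj: "x = 0" if "A x = 0" for x
  proof -
    have "A 0 = 0"
      using A_clinear linear_0 bounded_linear.linear unfolding clinear_op_def by blast
    then have "S.Q x = S.Q 0"
      using that S.K_inj[of "S.Q x" "S.Q 0"] by (simp add: A_def)
    then have "S.P (S.Q x) = S.P (S.Q 0)"
      by simp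
    then show ?thesis
      by (simp only: S.P_Q)
  qed
  interpret T: positive_compact T
  proof
    show "clinear_op T"
      using clinear_op_comp[OF A'_clinear A_clinear] by (simp add: T_def[abs_def])
    show "compact_op T"
      unfolding compact_op_def
    proof (intro allI impI)
      fix X :: "nat \<Rightarrow> 'a" assume X: "bounded (range X)"
      \<comment> \<open>\<open>T\<close> is \<open>K\<close> applied after this bounded map, so
        compactness of \<open>K\<close> suffices.\<close>
      have "bounded_linear (\<lambda>x. S'.Q (A x))"
        using clinear_op_comp[OF S'.Q_clinear A_clinear] by (simp add: clinear_op_def)
      from bounded_linear_image[OF X this] have "bounded (range (\<lambda>k. S'.Q (A (X k))))"
        by (simp add: image_image)
      then show "\<exists>z r. strict_mono (r :: nat \<Rightarrow> nat) \<and> (\<lambda>k. T (X (r k))) \<longlonglongrightarrow> z"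
        using compact[unfolded compact_op_def, THEN spec, THEN mp] unfolding T_def A'_def by blast
    qed
    show "cinner (T x) y = cinner x (T y)" for x y
      by (simp add: T_def A'A AA')
    show "Re (cinner (T x) x) > 0" if "x \<noteq> 0" for x
      using that A_inj by (auto simp: Re_T)
  qed
  obtain f \<tau> where f: "onb f" and \<tau>: "\<And>n. \<tau> n > 0" "decseq \<tau>" "\<tau> \<longlonglongrightarrow> 0"
    "\<And>n. T (f n) = of_real (\<tau> n) *\<^sub>C f n"
    "\<And>n x. (\<And>i. i < n \<Longrightarrow> cinner x (f i) = 0) \<Longrightarrow> Re (cinner (T x) x) \<le> \<tau> n * (norm x)\<^sup>2"
    using T.spectral_theorem[OF S.orthonormal_axioms] by blast
  interpret f: onb f by fact
  have sqrt_sq: "diag_op f (\<lambda>n. (sqrt (\<tau> n))\<^sup>2) = diag_op f \<tau>"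
    using \<tau>(1) by (simp add: less_imp_le)
  have T_diag: "(x, T x) \<in> diag_op f \<tau>" for x
    by (simp add: diag_op_def T.symmetric \<tau>(4) cinner_scaleC_right)
  have "W\<inverse> O adjoint_op (W\<inverse>) = op_graph T"
    unfolding adj unfolding W op_graph_comp by (simp add: T_def[abs_def] A_def A'_def)
  also have "op_graph T = diag_op f \<tau>"
  proof -
    have "(x, y) \<in> op_graph T \<longleftrightarrow> (x, y) \<in> diag_op f \<tau>" for x y
      unfolding op_graph_iff using T_diag[of x] f.diag_op_unique[of x y \<tau> "T x"] by blast
    then show ?thesis
      by auto
  qed
  finally have "W\<inverse> O adjoint_op (W\<inverse>) = diag_op f \<tau>" .
  then have "modulus_op (W\<inverse>) = sqrt_op (diag_op f \<tau>)"
    by (simp add: modulus_op_def)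
  also have "\<dots> = diag_op f (\<lambda>n. sqrt (\<tau> n))"
    unfolding sqrt_sq[symmetric] by (rule f.sqrt_diag_op) (simp add: \<tau>(1))
  finally have "singular_number (W\<inverse>) = (\<lambda>n. sqrt (\<tau> n))"
  proof (rule singular_number_eqI[OF f])
    show "decseq (\<lambda>n. sqrt (\<tau> n))"
      using \<tau>(2) by (simp add: decseq_def)
    show "(\<lambda>n. sqrt (\<tau> n)) \<longlonglongrightarrow> 0"
      using tendsto_real_sqrt[OF \<tau>(3)] by simp
  qed (simp add: \<tau>(1))
  moreover note min_max_bounds[OF small(1) T.positive_compact_axioms f _ \<tau>(1,2,4,5), of n]
  ultimately show "1 / (1 + \<beta>) * inverse (lam n) \<le> singular_number (W\<inverse>) n"
    and "singular_number (W\<inverse>) n \<le> 1 / (1 - \<beta>) * inverse (lam n)"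
    by (simp_all add: Re_T A_def)
qed

text \<open>A value below 1 excludes the default \<infinity>, so the series is summable; its terms
  being nonnegative, every finite rectangle is bounded by the sum, whose root serves as
  \<beta>.\<close>

lemma im_over_re_norm_less_1:
  assumes "im_over_re_norm G e lam < 1" and pos: "\<And>n. lam n > 0"
  obtains \<beta> where "0 \<le> \<beta>" "\<beta> < 1"
    "\<And>m l. (\<Sum>n<m. \<Sum>k<l. (cmod (cinner (G (e k)) (e n)))\<^sup>2 * lam n / lam k) \<le> \<beta>\<^sup>2"
proof -
  define a where "a = (\<lambda>(n, k). (cmod (cinner (G (e k)) (e n)))\<^sup>2 * lam n / lam k)"
  have summable: "a summable_on UNIV" and less: "sqrt (infsum a UNIV) < 1"
    using assms(1) unfolding im_over_re_norm_def a_def[symmetric] Let_def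
    by (simp_all split: if_splits)
  have nonneg: "a p \<ge> 0" for p
    using pos by (simp add: a_def less_imp_le split: prod.splits)
  then have "infsum a UNIV \<ge> 0"
    by (simp add: infsum_nonneg)
  moreover have "(\<Sum>n<m. \<Sum>k<l. (cmod (cinner (G (e k)) (e n)))\<^sup>2 * lam n / lam k) \<le> infsum a UNIV" for m l
  proof -
    have "(\<Sum>n<m. \<Sum>k<l. (cmod (cinner (G (e k)) (e n)))\<^sup>2 * lam n / lam k) = sum a ({..<m} \<times> {..<l})"
      by (simp add: a_def sum.cartesian_product)
    also have "\<dots> \<le> infsum a UNIV"
      by (rule finite_sum_le_infsum[OF summable]) (simp_all add: nonneg)
    finally show ?thesis .
  qed
  ultimately show thesis
    using less by (intro that[of "sqrt (infsum a UNIV)"]) simp_all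
qed

theorem theorem1:
  fixes Hp M :: "'h :: chilbert_space set"
    and ip :: "'h \<Rightarrow> 'h \<Rightarrow> complex"
    and L G :: "'h \<Rightarrow> 'h"
    and C0 C1 C2 :: real
    and W H :: "'h operator"
    and lam :: "nat \<Rightarrow> real" and e :: "nat \<Rightarrow> 'h"
  assumes "infinite_dimensional TYPE('h)"
    and "separable_space (euclidean :: 'h topology)"
    and "hilbert_on Hp ip" and "closure Hp = UNIV"
    and "C0 > 0" and "\<forall>f\<in>Hp. norm f \<le> C0 * ip_norm ip f"
    and "compact (closure {f \<in> Hp. ip_norm ip f \<le> 1})"
    and "csubspace M" and "M \<subseteq> Hp"
    and "\<forall>f\<in>Hp. \<forall>\<epsilon>>0. \<exists>g\<in>M. ip_norm ip (f - g) < \<epsilon>"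
    and "\<forall>f\<in>M. \<forall>g\<in>M. L (f + g) = L f + L g"
    and "\<forall>c. \<forall>f\<in>M. L (c *\<^sub>C f) = c *\<^sub>C L f"
    and "C1 > 0" and "\<forall>f\<in>M. \<forall>g\<in>M. cmod (cinner (L f) g) \<le> C1 * ip_norm ip f * ip_norm ip g"
    and "C2 > 0" and "\<forall>f\<in>M. Re (cinner (L f) f) \<ge> C2 * (ip_norm ip f)\<^sup>2"
    and "W = friedrichs M L" and "H = friedrichs_Re M L"
    and "eigenvalues_nondecreasing H lam"
    and "orthonormal_basis e" and "\<forall>n. (e n, lam n *\<^sub>C e n) \<in> H"
    and "kato_factor W H G"
    and "im_over_re_norm G e lam < 1"
  shows "\<exists>c C. c > 0 \<and> C > 0 \<and>
    (\<forall>n. c * inverse (lam n) \<le> singular_number (W\<inverse>) n \<and>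
         singular_number (W\<inverse>) n \<le> C * inverse (lam n))"
proof -
  interpret F: coercive_form Hp M ip L C0 C1 C2
    using assms(3,5-16) by (unfold_locales) blast+
  have onb: "onb e"
    by (rule onb_of_orthonormal_basis) fact
  interpret onb e by fact
  have eig: "(e n, of_real (lam n) *\<^sub>C e n) \<in> F.H" for n
    using assms(18,21) by simp
  have lam_pos: "lam n > 0" for n
    by (rule F.eigenvalue_pos[OF onb eig])
  have H: "H = diag_op e lam"
    using F.H_eq_diag_op[OF onb eig] assms(18) by simp
  also have "diag_op e lam = diag_op e (\<lambda>n. (sqrt (lam n))\<^sup>2)"
    using lam_pos by (simp add: less_imp_le)
  finally have sqrt_H: "sqrt_op H = diag_op e (\<lambda>n. sqrt (lam n))"
    using sqrt_diag_op[of "\<lambda>n. sqrt (lam n)"] lam_pos by simp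
  obtain \<beta> where \<beta>: "0 \<le> \<beta>" "\<beta> < 1"
    "\<And>m l. (\<Sum>n<m. \<Sum>k<l. (cmod (cinner (G (e k)) (e n)))\<^sup>2 * lam n / lam k) \<le> \<beta>\<^sup>2"
    using im_over_re_norm_less_1[OF assms(23) lam_pos] by blast
  have G: "clinear_op G" "\<And>x y. cinner (G x) y = cinner x (G y)"
    using assms(22) by (auto simp: kato_factor_def clinear_op_def)
  have "incseq lam"
    using assms(19) by (simp add: eigenvalues_nondecreasing_def)
  then have small: "relatively_small e lam G \<beta>"
    using lam_pos G \<beta> by unfold_locales auto
  \<comment> \<open>The matrix coefficients of \<open>-G\<close> have the same moduli as those of
    \<open>G\<close>, so the same \<beta> serves.\<close>
  have small': "relatively_small e lam (\<lambda>x. - G x) \<beta>"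
  proof unfold_locales
    show "clinear_op (\<lambda>x. - G x)"
      using G(1) by (auto simp: clinear_op_def bounded_linear_minus scaleC.minus_right)
  qed (use lam_pos G \<beta> \<open>incseq lam\<close> in \<open>auto simp: cinner.minus_left cinner.minus_right\<close>)
  interpret S: relatively_small e lam G \<beta> by fact
  interpret S': relatively_small e lam "\<lambda>x. - G x" \<beta> by fact
  have W: "W\<inverse> = op_graph (\<lambda>w. S.K (S.Q w))"
    using assms(22) S.factorised_inverse by (simp add: kato_factor_def sqrt_H)
  have "adjoint_op W = diag_op e S'.r O op_graph (\<lambda>x. x - \<i> *\<^sub>C G x) O diag_op e S'.r"
    using assms(22) unfolding kato_factor_def sqrt_H by blast
  also have "(\<lambda>x. x - \<i> *\<^sub>C G x) = (\<lambda>x. x + \<i> *\<^sub>C - G x)"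
    by (simp add: scaleC.minus_right)
  finally have adj: "adjoint_op (W\<inverse>) = op_graph (\<lambda>w. S.K (S'.Q w))"
    using S'.factorised_inverse by (simp only: adjoint_op_converse)
  \<comment> \<open>The pairs (K y, y) belong to \<open>H\<close>, so compactness of the embedding
    reaches \<open>K\<close>.\<close>
  have "compact_op S.K"
    unfolding compact_op_def
  proof (intro allI impI)
    fix X :: "nat \<Rightarrow> 'h" assume "bounded (range X)"
    then show "\<exists>z r. strict_mono (r :: nat \<Rightarrow> nat) \<and> (\<lambda>k. S.K (X (r k))) \<longlonglongrightarrow> z"
      by (rule F.H_precompact) (use S.K_diag_op H assms(18) in simp)
  qed
  from singular_number_bounds[OF small small' this adj W]
  show ?thesis
    using \<beta>(1,2) by (intro exI[of _ "1 / (1 + \<beta>)"] exI[of _ "1 / (1 - \<beta>)"] conjI allI) simp_all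
qed

end
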